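(* Let $N,k\ge1$ be integers, write $z=(x,y)\in\mathbb{R}^{N}\times\mathbb{R}^k$, and let $\Delta_{\mathcal{G}}=\Delta_x+|x|^2\Delta_y$. Let $0<\gamma<1$, $p>1$, and let $u_0\in L^1(\mathbb{R}^{N+k})$ satisfy $\int_{\mathbb{R}^{N+k}}u_0(z)\,dz>0$. If $$p\le 1+\frac{2(2-\gamma)}{N+2k-2+2\gamma}\quad\text{or}\quad p<\frac1\gamma,$$ then the problem $$u_t-\Delta_{\mathcal{G}}u=\int_0^t(t-s)^{-\gamma}|u|^{p-1}u(s)\,ds\ \text{ in }\mathbb{R}^{N+k}\times(0,\infty),\qquad u(z,0)=u_0(z),$$ admits no global nonnegative weak solution.
   Context: Here $\Delta_x,\Delta_y$ are the Euclidean Laplacians in $x$ and $y$. For $T>0$, a function $u$ is a weak solution on $[0,T]$ if $u$, $\int_0^t(t-s)^{-\gamma}|u|^{p-1}u(s)\,ds\in L^1_{\mathrm{loc}}(\mathbb{R}^{N+k}\times(0,T))$ and for every compactly supported $\varphi\in C^{2,1}(\mathbb{R}^{N+k}\times[0,T])$ with $\varphi(\cdot,T)=0$, $$-\int_{\mathbb{R}^{N+k}}u_0\varphi(z,0)\,dz=\int_0^T\!\!\int_{\mathbb{R}^{N+k}}\Big(\int_0^t(t-s)^{-\gamma}|u|^{p-1}u(z,s)\,ds\Big)\varphi\,dz\,dt+\int_0^T\!\!\int_{\mathbb{R}^{N+k}}u\,\Delta_{\mathcal{G}}\varphi\,dz\,dt+\int_0^T\!\!\int_{\mathbb{R}^{N+k}}u\,\varphi_t\,dz\,dt.$$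 A global weak solution is a weak solution on $[0,T]$ for every $T>0$. *)

theory Defs
  imports "HOL-Analysis.Analysis"
begin

definition dpar :: "('a::real_normed_vector) \<Rightarrow> ('a \<Rightarrow> real \<Rightarrow> real) \<Rightarrow> 'a \<Rightarrow> real \<Rightarrow> real" where
  "dpar v f z t = deriv (\<lambda>r. f (z + r *\<^sub>R v) t) 0"

definition dpar_exists :: "('a::real_normed_vector) \<Rightarrow> ('a \<Rightarrow> real \<Rightarrow> real) \<Rightarrow> bool" where
  "dpar_exists v f \<longleftrightarrow> (\<forall>z t. (\<lambda>r. f (z + r *\<^sub>R v) t) differentiable (at 0))"

definition dtime :: "('a \<Rightarrow> real \<Rightarrow> real) \<Rightarrow> 'a \<Rightarrow> real \<Rightarrow> real" where
  "dtime f z t = deriv (\<lambda>s. f z s) t"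

definition C21 :: "('a::euclidean_space \<Rightarrow> real \<Rightarrow> real) \<Rightarrow> bool" where
  "C21 f \<longleftrightarrow>
     continuous_on UNIV (\<lambda>(z,t). f z t) \<and>
     (\<forall>v\<in>Basis. dpar_exists v f \<and> continuous_on UNIV (\<lambda>(z,t). dpar v f z t) \<and>
        (\<forall>w\<in>Basis. dpar_exists w (dpar v f) \<and>
           continuous_on UNIV (\<lambda>(z,t). dpar w (dpar v f) z t))) \<and>
     (\<forall>z t. (\<lambda>s. f z s) differentiable (at t)) \<and>
     continuous_on UNIV (\<lambda>(z,t). dtime f z t)"

definition grushin :: "((real^'n) \<times> (real^'k) \<Rightarrow> real \<Rightarrow> real) \<Rightarrow> (real^'n) \<times> (real^'k) \<Rightarrow> real \<Rightarrow> real" where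
  "grushin f z t =
     (\<Sum>b\<in>(Basis :: (real^'n) set). dpar (b, 0) (dpar (b, 0) f) z t)
     + (norm (fst z))\<^sup>2 * (\<Sum>b\<in>(Basis :: (real^'k) set). dpar (0, b) (dpar (0, b) f) z t)"

definition test_fun :: "real \<Rightarrow> ((real^'n) \<times> (real^'k) \<Rightarrow> real \<Rightarrow> real) \<Rightarrow> bool" where
  "test_fun T \<phi> \<longleftrightarrow> C21 \<phi> \<and>
     (\<exists>K. compact K \<and> (\<forall>z t. t \<in> {0..T} \<and> z \<notin> K \<longrightarrow> \<phi> z t = 0)) \<and>
     (\<forall>z. \<phi> z T = 0)"

definition loc_int :: "real \<Rightarrow> ((real^'n) \<times> (real^'k) \<Rightarrow> real \<Rightarrow> real) \<Rightarrow> bool" where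
  "loc_int T f \<longleftrightarrow> (\<forall>K. compact K \<and> K \<subseteq> UNIV \<times> {0<..<T} \<longrightarrow>
      set_integrable lborel K (\<lambda>(z,t). f z t))"

definition memory :: "real \<Rightarrow> real \<Rightarrow> ((real^'n) \<times> (real^'k) \<Rightarrow> real \<Rightarrow> real) \<Rightarrow> (real^'n) \<times> (real^'k) \<Rightarrow> real \<Rightarrow> real" where
  "memory \<gamma> p u z t = (LINT s:{0..t}|lborel. (t - s) powr (- \<gamma>) * (\<bar>u z s\<bar> powr (p - 1) * u z s))"

definition weak_solution :: "real \<Rightarrow> real \<Rightarrow> ((real^'n) \<times> (real^'k) \<Rightarrow> real)
     \<Rightarrow> real \<Rightarrow> ((real^'n) \<times> (real^'k) \<Rightarrow> real \<Rightarrow> real) \<Rightarrow> bool" where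
  "weak_solution \<gamma> p u0 T u \<longleftrightarrow>
     loc_int T u \<and>
     (AE w in lborel. w \<in> UNIV \<times> {0<..<T} \<longrightarrow>
        set_integrable lborel {0..snd w}
          (\<lambda>s. (snd w - s) powr (- \<gamma>) * (\<bar>u (fst w) s\<bar> powr (p - 1) * u (fst w) s))) \<and>
     loc_int T (memory \<gamma> p u) \<and>
     (\<forall>\<phi>. test_fun T \<phi> \<longrightarrow>
        integrable lborel (\<lambda>z. u0 z * \<phi> z 0) \<and>
        set_integrable lborel (UNIV \<times> {0<..<T}) (\<lambda>(z,t). memory \<gamma> p u z t * \<phi> z t) \<and>
        set_integrable lborel (UNIV \<times> {0<..<T}) (\<lambda>(z,t). u z t * grushin \<phi> z t) \<and>
        set_integrable lborel (UNIV \<times> {0<..<T}) (\<lambda>(z,t). u z t * dtime \<phi> z t) \<and>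
        - (LINT z|lborel. u0 z * \<phi> z 0)
          = (LINT w:UNIV \<times> {0<..<T}|lborel. memory \<gamma> p u (fst w) (snd w) * \<phi> (fst w) (snd w))
          + (LINT w:UNIV \<times> {0<..<T}|lborel. u (fst w) (snd w) * grushin \<phi> (fst w) (snd w))
          + (LINT w:UNIV \<times> {0<..<T}|lborel. u (fst w) (snd w) * dtime \<phi> (fst w) (snd w)))"

definition global_weak_solution :: "real \<Rightarrow> real \<Rightarrow> ((real^'n) \<times> (real^'k) \<Rightarrow> real)
     \<Rightarrow> ((real^'n) \<times> (real^'k) \<Rightarrow> real \<Rightarrow> real) \<Rightarrow> bool" where
  "global_weak_solution \<gamma> p u0 u \<longleftrightarrow> (\<forall>T>0. weak_solution \<gamma> p u0 T u)"

end

theory Submission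
  imports Defs
begin

text \<open>
  Test the equation with $\varphi(z,t)=c(z)^l(1-t/T)^{l-1}$, where $c=(1-\rho/S^2)_+$ and
  $\rho(x,y)=|x|^4+4|y|^2$ is the Grushin gauge, for which $\Delta_{\mathcal G}\varphi$ is bounded by
  $S^{-1}(|x|^2/S)$ times the power $l-2$ of $c\,(1-t/T)$. By Tonelli the memory term
  dominates a multiple of $T^{1-\gamma}W(S,T)$ with
  $W(S,T)=\int\!\int u^p\,(c\,(1-t/T)_+)^l$, and Young's inequality bounds $W(S,T)$, up to constants, by
  $T^{1-(2-\gamma)q}S^{Q/2}+T^{1-(1-\gamma)q}S^{Q/2-q}$, where $q=p/(p-1)$ and $Q=N+2k$.
  If $p<1/\gamma$, let $T\to\infty$ with $S$ fixed. Otherwise take $S=bT$: the bound makes $u^p$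
  integrable, so the Young term coming from $\Delta_{\mathcal G}\varphi$, whose factor $|x|^2/S$ tends
  to $0$, vanishes as $T\to\infty$, and then $b\to0$. In both cases $W=0$, so $u=0$ on the support
  of $\varphi$ and the weak formulation forces $\int u_0\,c^l\le 0$.
\<close>

text \<open>\<open>S\<close> scales like |x|^2, like |y| and, parabolically, like time, so
  \<open>S = b T\<close> is the natural scaling of the equation. Both Young terms then carry the
  same power T^(1 + Q/2 - (2-\<gamma>)q), whose exponent is nonpositive exactly under the first
  condition on p. In the critical case it is zero: scaling alone gives boundedness and no smallness.
  The smallness comes from the degenerate operator, which applied to a function of the gauge
  produces the factor |x|^2/S. This factor is kept next to u^p in Young's inequality, and the
  inequality is used with a free weight K. The order of limits matters: for fixed b and K, T to
  infinity removes K (|x|^2/S) u^p; then K to infinity removes K^(-1/(p-1)) b^(Q/2-q), whose power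
  of b may be negative; only then does b to 0 remove the time term b^(Q/2). The test function has
  exponent l in space but l-1 in time because the time integration in the memory term raises l-1 to
  l, and this makes the weight in W a power of one product.\<close>

section \<open>The Grushin gauge, the cutoff and the derivatives of the test function\<close>

definition grushin_gauge :: "('a::real_inner) \<times> ('b::real_inner) \<Rightarrow> real" where
  "grushin_gauge z = (fst z \<bullet> fst z)\<^sup>2 + 4 * (snd z \<bullet> snd z)"

definition cutoff :: "real \<Rightarrow> ('a::real_inner) \<times> ('b::real_inner) \<Rightarrow> real" where
  "cutoff S z = max 0 (1 - grushin_gauge z / S\<^sup>2)"

text \<open>Only the kink at 0 needs care: the difference quotient there is
  \<open>max 0 h ^ (n - 1)\<close>, which tends to 0 once n is at least 2. Differentiating the
  cutoff power twice therefore asks for l at least 3.\<close>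

lemma has_real_derivative_pos_part_power:
  fixes x :: real
  assumes "2 \<le> n"
  shows "((\<lambda>x. max 0 x ^ n) has_real_derivative real n * max 0 x ^ (n - 1)) (at x)"
proof -
  obtain j where n: "n = Suc (Suc j)"
    using assms by (metis One_nat_def Suc_1 Suc_le_D Suc_le_mono)
  consider "x > 0" | "x < 0" | "x = 0" by linarith
  then show ?thesis
  proof cases
    case 1
    have "((\<lambda>x. x ^ n) has_real_derivative real n * max 0 x ^ (n - 1)) (at x)"
      using 1 by (auto intro!: derivative_eq_intros)
    then show ?thesis
      by (rule has_field_derivative_transform_within_open[of _ _ _ "{0<..}"]) (use 1 in auto)
  next
    case 2
    have "((\<lambda>x. 0) has_real_derivative real n * max 0 x ^ (n - 1)) (at x)"
      using 2 n by (auto intro!: derivative_eq_intros)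
    then show ?thesis
      by (rule has_field_derivative_transform_within_open[of _ _ _ "{..<0}"]) (use 2 n in auto)
  next
    case 3
    have "((\<lambda>h::real. max 0 h ^ Suc j) \<longlongrightarrow> max 0 0 ^ Suc j) (at 0)"
      by (intro tendsto_intros)
    moreover have "(\<lambda>h::real. (max 0 (0 + h) ^ n - max 0 0 ^ n) / h) = (\<lambda>h. max 0 h ^ Suc j)"
      by (auto simp: n max_def fun_eq_iff)
    ultimately show ?thesis
      using 3 n by (simp add: DERIV_def)
  qed
qed

lemma has_real_derivative_grushin_gauge_line:
  "((\<lambda>r. grushin_gauge (z + r *\<^sub>R v)) has_real_derivative
     4 * (fst z \<bullet> fst z) * (fst z \<bullet> fst v) + 8 * (snd z \<bullet> snd v)) (at 0)"
  unfolding grushin_gauge_def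
  by (auto intro!: derivative_eq_intros simp: inner_commute algebra_simps power2_eq_square)

definition gauge_diff :: "('a::real_inner) \<times> ('b::real_inner) \<Rightarrow> 'a \<times> 'b \<Rightarrow> real" where
  "gauge_diff v z = 4 * (fst z \<bullet> fst z) * (fst z \<bullet> fst v) + 8 * (snd z \<bullet> snd v)"

definition gauge_diff2 :: "('a::real_inner) \<times> ('b::real_inner) \<Rightarrow> 'a \<times> 'b \<Rightarrow> 'a \<times> 'b \<Rightarrow> real" where
  "gauge_diff2 v w z = 8 * (fst z \<bullet> fst v) * (fst z \<bullet> fst w) + 4 * (fst z \<bullet> fst z) * (fst v \<bullet> fst w)
     + 8 * (snd v \<bullet> snd w)"

lemma has_real_derivative_gauge_diff_line:
  "((\<lambda>r. gauge_diff v (z + r *\<^sub>R w)) has_real_derivative gauge_diff2 v w z) (at 0)"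
  unfolding gauge_diff_def gauge_diff2_def
  by (auto intro!: derivative_eq_intros simp: inner_commute algebra_simps)

lemma has_real_derivative_cutoff_line:
  assumes "2 \<le> n"
  shows "((\<lambda>r. cutoff S (z + r *\<^sub>R v) ^ n) has_real_derivative
     - (real n * cutoff S z ^ (n - 1) * gauge_diff v z / S\<^sup>2)) (at 0)"
proof -
  have "((\<lambda>r. 1 - grushin_gauge (z + r *\<^sub>R v) / S\<^sup>2) has_real_derivative - (gauge_diff v z / S\<^sup>2)) (at 0)"
    using DERIV_diff[OF DERIV_const DERIV_cdivide[OF has_real_derivative_grushin_gauge_line[of z v]], of 1 "S\<^sup>2"]
    by (simp add: gauge_diff_def)
  from DERIV_chain2[OF has_real_derivative_pos_part_power[OF assms] this]
  show ?thesis
    by (simp add: cutoff_def)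
qed

text \<open>
  The time factor is a polynomial and needs no truncation: a test function has to vanish only
  at time $T$ and, for times in $[0,T]$, outside a compact set.
\<close>
definition test_bump :: "nat \<Rightarrow> real \<Rightarrow> real \<Rightarrow> ('a::real_inner) \<times> ('b::real_inner) \<Rightarrow> real \<Rightarrow> real" where
  "test_bump l S T z t = cutoff S z ^ l * (1 - t / T) ^ (l - 1)"

lemma has_real_derivative_test_bump_line:
  assumes "2 \<le> l"
  shows "((\<lambda>r. test_bump l S T (z + r *\<^sub>R v) t) has_real_derivative
     - (real l * cutoff S z ^ (l - 1) * gauge_diff v z / S\<^sup>2 * (1 - t / T) ^ (l - 1))) (at 0)"
  unfolding test_bump_def
  by (rule derivative_eq_intros has_real_derivative_cutoff_line[OF assms] refl)+ simp

lemma dpar_test_bump: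
  assumes "2 \<le> l"
  shows "dpar v (test_bump l S T) =
    (\<lambda>z t. - (real l * cutoff S z ^ (l - 1) * gauge_diff v z / S\<^sup>2 * (1 - t / T) ^ (l - 1)))"
  unfolding dpar_def fun_eq_iff
  using DERIV_imp_deriv[OF has_real_derivative_test_bump_line[OF assms]] by blast

definition bump_diff2 :: "nat \<Rightarrow> real \<Rightarrow> real \<Rightarrow> ('a::real_inner) \<times> ('b::real_inner) \<Rightarrow> 'a \<times> 'b \<Rightarrow> 'a \<times> 'b \<Rightarrow> real \<Rightarrow> real" where
  "bump_diff2 l S T v w z t =
     (real l * real (l - 1) * cutoff S z ^ (l - 2) * gauge_diff v z * gauge_diff w z / S ^ 4
     - real l * cutoff S z ^ (l - 1) * gauge_diff2 v w z / S\<^sup>2) * (1 - t / T) ^ (l - 1)"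

lemma has_real_derivative_dpar_test_bump_line:
  assumes "3 \<le> l"
  shows "((\<lambda>r. dpar v (test_bump l S T) (z + r *\<^sub>R w) t) has_real_derivative bump_diff2 l S T v w z t) (at 0)"
proof -
  have l: "2 \<le> l" "2 \<le> l - 1" "l - 1 - 1 = l - 2"
    using assms by auto
  let ?K = "- (real l / S\<^sup>2 * (1 - t / T) ^ (l - 1))"
  have "((\<lambda>r. ?K * (cutoff S (z + r *\<^sub>R w) ^ (l - 1) * gauge_diff v (z + r *\<^sub>R w)))
     has_real_derivative bump_diff2 l S T v w z t) (at 0)"
    using DERIV_cmult[OF DERIV_mult[OF has_real_derivative_cutoff_line[OF l(2)] has_real_derivative_gauge_diff_line],
        of ?K S z w v]
    by (rule DERIV_cong)
      (cases "S = 0"; simp add: bump_diff2_def l(3)[unfolded One_nat_def]; simp add: field_simps power2_eq_square power4_eq_xxxx numeral_2_eq_2)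
  moreover have "(\<lambda>r. ?K * (cutoff S (z + r *\<^sub>R w) ^ (l - 1) * gauge_diff v (z + r *\<^sub>R w))) =
    (\<lambda>r. dpar v (test_bump l S T) (z + r *\<^sub>R w) t)"
    by (simp add: dpar_test_bump[OF l(1)] mult_ac)
  ultimately show ?thesis
    by simp
qed

lemma dpar_dpar_test_bump:
  assumes "3 \<le> l"
  shows "dpar w (dpar v (test_bump l S T)) = bump_diff2 l S T v w"
  unfolding dpar_def[of w] fun_eq_iff
  using DERIV_imp_deriv[OF has_real_derivative_dpar_test_bump_line[OF assms]] by blast

lemma has_real_derivative_test_bump_time:
  assumes "T > 0"
  shows "(test_bump l S T z has_real_derivative - (real (l - 1) / T * cutoff S z ^ l * (1 - t / T) ^ (l - 2))) (at t)"
proof -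
  have "l - 1 - 1 = l - 2" by simp
  then show ?thesis
  unfolding test_bump_def
  using assms by (auto intro!: derivative_eq_intros)
qed

lemma dtime_test_bump:
  assumes "T > 0"
  shows "dtime (test_bump l S T) = (\<lambda>z t. - (real (l - 1) / T * cutoff S z ^ l * (1 - t / T) ^ (l - 2)))"
  unfolding dtime_def fun_eq_iff
  using DERIV_imp_deriv[OF has_real_derivative_test_bump_time[OF assms]] by blast

lemma continuous_on_cutoff [continuous_intros]:
  "continuous_on A f \<Longrightarrow> continuous_on A (\<lambda>x. cutoff S (f x))"
  \<comment> \<open>For \<open>S = 0\<close> the convention \<open>x / 0 = 0\<close> makes the
    cutoff constantly 1; otherwise the denominator is nonzero and the quotient is
    continuous.\<close>
  unfolding cutoff_def grushin_gauge_def by (cases "S = 0") (auto intro!: continuous_intros)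

lemma C21_test_bump:
  assumes "3 \<le> l" "T > 0"
  shows "C21 (test_bump l S T :: ('a::euclidean_space) \<times> ('b::euclidean_space) \<Rightarrow> real \<Rightarrow> real)"
proof -
  have l: "2 \<le> l" using assms by simp
  have "dpar_exists v (test_bump l S T)" for v :: "'a \<times> 'b"
    unfolding dpar_exists_def using has_real_derivative_test_bump_line[OF l] real_differentiable_def by blast
  moreover have "dpar_exists w (dpar v (test_bump l S T))" for v w :: "'a \<times> 'b"
    unfolding dpar_exists_def using has_real_derivative_dpar_test_bump_line[OF assms(1)] real_differentiable_def by blast
  moreover have "test_bump l S T z differentiable at t" for z :: "'a \<times> 'b" and t
    using has_real_derivative_test_bump_time[OF assms(2)] real_differentiable_def by blast
  moreover have "continuous_on UNIV (\<lambda>(z :: 'a \<times> 'b, t). test_bump l S T z t)"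
    using assms(2) unfolding test_bump_def case_prod_beta by (auto intro!: continuous_intros)
  moreover have "continuous_on UNIV (\<lambda>(z :: 'a \<times> 'b, t). dtime (test_bump l S T) z t)"
    using assms(2) unfolding dtime_test_bump[OF assms(2)] case_prod_beta by (auto intro!: continuous_intros)
  moreover have "continuous_on UNIV (\<lambda>(z, t). dpar v (test_bump l S T) z t)" for v :: "'a \<times> 'b"
    using assms(2) unfolding dpar_test_bump[OF l] case_prod_beta gauge_diff_def
    by (cases "S = 0") (auto intro!: continuous_intros)
  moreover have "continuous_on UNIV (\<lambda>(z, t). dpar w (dpar v (test_bump l S T)) z t)" for v w :: "'a \<times> 'b"
    using assms(2) unfolding dpar_dpar_test_bump[OF assms(1)] case_prod_beta bump_diff2_def gauge_diff_def gauge_diff2_def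
    by (cases "S = 0") (auto intro!: continuous_intros)
  ultimately show ?thesis
    unfolding C21_def by blast
qed

section \<open>Support of the cutoff and the Grushin operator on the test function\<close>

lemma cutoff_nonneg [simp]: "0 \<le> cutoff S z"
  by (simp add: cutoff_def)

lemma grushin_gauge_nonneg [simp]: "0 \<le> grushin_gauge z"
  by (simp add: grushin_gauge_def)

lemma cutoff_le_1 [simp]: "cutoff S z \<le> 1"
  by (simp add: cutoff_def)

lemma cutoff_pos_iff:
  assumes "S > 0"
  shows "cutoff S z > 0 \<longleftrightarrow> grushin_gauge z < S\<^sup>2"
  using assms by (auto simp: cutoff_def less_max_iff_disj divide_simps)

text \<open>Each of the two nonnegative summands of the gauge is below S^2. The different powers of
  S in x and y are what make the volume of the support of order S^(Q/2). The bound on y is crude,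
  since the factor 4 in the gauge would give S/2.\<close>

lemma cutoff_pos_imp:
  assumes "S > 0" "cutoff S z > 0"
  shows "norm (fst z) \<le> sqrt S" "norm (snd z) \<le> S"
proof -
  have *: "grushin_gauge z < S\<^sup>2"
    using assms cutoff_pos_iff by blast
  have "(fst z \<bullet> fst z)\<^sup>2 \<le> S\<^sup>2"
    using * inner_ge_zero[of "snd z"] unfolding grushin_gauge_def by linarith
  then have "fst z \<bullet> fst z \<le> S"
    using assms(1) power2_le_imp_le by force
  then show "norm (fst z) \<le> sqrt S"
    by (simp add: norm_eq_sqrt_inner)
  have "norm (snd z) ^ 2 \<le> S\<^sup>2"
    using * zero_le_power2[of "fst z \<bullet> fst z"] inner_ge_zero[of "snd z"] unfolding grushin_gauge_def power2_norm_eq_inner by linarith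
  then show "norm (snd z) \<le> S"
    using assms(1) power2_le_imp_le by force
qed

lemma test_fun_test_bump:
  assumes "3 \<le> l" "T > 0" "S > 0"
  shows "test_fun T (test_bump l S T)"
  unfolding test_fun_def
proof (intro conjI C21_test_bump assms allI exI[of _ "cball 0 (sqrt S) \<times> cball 0 S"] impI)
  fix z :: "(real^'a) \<times> (real^'b)" and t
  assume "t \<in> {0..T} \<and> z \<notin> cball 0 (sqrt S) \<times> cball 0 S"
  then have "\<not> cutoff S z > 0"
    using cutoff_pos_imp[OF assms(3), of z] by (cases z) auto
  then have "cutoff S z = 0"
    using cutoff_nonneg[of S z] by linarith
  then show "test_bump l S T z t = 0"
    using assms by (simp add: test_bump_def power_0_left)
qed (use assms in \<open>auto simp: test_bump_def power_0_left intro!: compact_Times\<close>)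

text \<open>Chain rule with two identities for the gauge \<rho>: its squared Grushin gradient
  |grad_x \<rho>|^2 + |x|^2 |grad_y \<rho>|^2 equals 16 |x|^2 \<rho>, and its Grushin Laplacian
  equals (8 + 4N + 8k) |x|^2. The coefficient 4 of |y|^2 in the gauge is chosen so that the first
  identity closes up. Both carry |x|^2, the source of the decaying factor.\<close>

lemma grushin_test_bump:
  fixes z :: "(real^'n) \<times> (real^'k)"
  assumes "3 \<le> l"
  defines "X \<equiv> fst z \<bullet> fst z"
  shows "grushin (test_bump l S T) z t =
    (real l * real (l - 1) * cutoff S z ^ (l - 2) * (16 * X * grushin_gauge z) / S ^ 4
      - real l * cutoff S z ^ (l - 1) * (X * (8 + 4 * real CARD('n) + 8 * real CARD('k))) / S\<^sup>2)
      * (1 - t / T) ^ (l - 1)"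
proof -
  have 1: "(\<Sum>b\<in>Basis. (x \<bullet> b) * (x \<bullet> b)) = x \<bullet> x" for x :: "'c::euclidean_space"
    by (simp add: euclidean_inner[of x x])
  have 2: "(\<Sum>b\<in>(Basis::'c set). b \<bullet> b) = DIM('c::euclidean_space)"
    by (simp add: inner_Basis)
  have [simp]: "DIM(real^'n) = CARD('n)" "DIM(real^'k) = CARD('k)" by auto
  let ?A = "real l * real (l - 1) * cutoff S z ^ (l - 2) / S ^ 4"
  let ?B = "real l * cutoff S z ^ (l - 1) / S\<^sup>2"
  let ?s = "(1 - t / T) ^ (l - 1)"
  have "(\<Sum>b\<in>(Basis :: (real^'n) set). bump_diff2 l S T (b, 0) (b, 0) z t)
    = (\<Sum>b\<in>(Basis :: (real^'n) set). (?A * 16 * X\<^sup>2 - ?B * 8) * ?s * ((fst z \<bullet> b) * (fst z \<bullet> b)) - ?B * ?s * 4 * X * (b \<bullet> b))"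
    by (rule sum.cong) (auto simp: bump_diff2_def gauge_diff_def gauge_diff2_def X_def algebra_simps add_divide_distrib diff_divide_distrib power2_eq_square)
  also have "\<dots> = (?A * 16 * X\<^sup>2 - ?B * 8) * ?s * X - ?B * ?s * 4 * X * real CARD('n)"
    unfolding sum_subtractf sum_distrib_left[symmetric] 1 2 X_def by simp
  finally have x: "(\<Sum>b\<in>(Basis :: (real^'n) set). bump_diff2 l S T (b, 0) (b, 0) z t) = \<dots>" .
  have "(\<Sum>b\<in>(Basis :: (real^'k) set). bump_diff2 l S T (0, b) (0, b) z t)
    = (\<Sum>b\<in>(Basis :: (real^'k) set). (?A * 64 * ?s * ((snd z \<bullet> b) * (snd z \<bullet> b)) - ?B * ?s * 8 * (b \<bullet> b)))"
    by (rule sum.cong) (auto simp: bump_diff2_def gauge_diff_def gauge_diff2_def X_def algebra_simps add_divide_distrib diff_divide_distrib power2_eq_square)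
  also have "\<dots> = ?A * 64 * ?s * (snd z \<bullet> snd z) - ?B * ?s * 8 * real CARD('k)"
    unfolding sum_subtractf sum_distrib_left[symmetric] 1 2 by simp
  finally have y: "(\<Sum>b\<in>(Basis :: (real^'k) set). bump_diff2 l S T (0, b) (0, b) z t) = \<dots>" .
  show ?thesis
    unfolding grushin_def dpar_dpar_test_bump[OF assms(1)] x y power2_norm_eq_inner grushin_gauge_def X_def
    by (simp add: algebra_simps power2_eq_square add_divide_distrib diff_divide_distrib)
qed

text \<open>On the support \<rho> <= S^2 turns the factor S^(-4) of the gradient term into S^(-2),
  and the powers l-1 are lowered to l-2 since their bases lie in [0,1]. The quotient |x|^2/S is not
  estimated by 1: its pointwise decay settles the critical case.\<close>

lemma abs_grushin_test_bump_le:
  fixes z :: "(real^'n) \<times> (real^'k)"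
  assumes "3 \<le> l" "S > 0" "T > 0" "0 < t" "t < T"
  shows "\<bar>grushin (test_bump l S T) z t\<bar> \<le>
    (16 * (real l)\<^sup>2 + real l * (8 + 4 * real CARD('n) + 8 * real CARD('k))) * ((norm (fst z))\<^sup>2 / S) / S
      * (cutoff S z * (1 - t / T)) ^ (l - 2)"
proof (cases "cutoff S z > 0")
  case False
  then have "cutoff S z = 0"
    using cutoff_nonneg[of S z] by linarith
  then show ?thesis
    using assms by (simp add: grushin_test_bump power_0_left)
next
  case True
  define c s X D where "c = cutoff S z" and "s = 1 - t / T" and "X = fst z \<bullet> fst z"
    and "D = 8 + 4 * real CARD('n) + 8 * real CARD('k)"
  have s: "0 \<le> s" "s \<le> 1" using assms by (auto simp: s_def)
  have c: "0 \<le> c" "c \<le> 1" by (auto simp: c_def)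
  have X: "0 \<le> X" "0 \<le> D" by (auto simp: X_def D_def)
  have g: "grushin_gauge z / S\<^sup>2 \<le> 1" "0 \<le> grushin_gauge z / S\<^sup>2"
    using True assms cutoff_pos_iff[of S z] by auto
  have l2: "real l * real (l - 1) \<le> (real l)\<^sup>2"
    unfolding power2_eq_square by (intro mult_left_mono) auto
  have c1: "c ^ (l - 1) \<le> c ^ (l - 2)" and s1: "s ^ (l - 1) \<le> s ^ (l - 2)"
    using c s assms by (auto intro!: power_decreasing)
  have a1: "real l * real (l - 1) * c ^ (l - 2) * (16 * X * grushin_gauge z) / S ^ 4
     \<le> 16 * (real l)\<^sup>2 * (X / S\<^sup>2) * c ^ (l - 2)"
  proof -
    have "real l * real (l - 1) * c ^ (l - 2) * (16 * X * grushin_gauge z) / S ^ 4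
      = (real l * real (l - 1)) * (grushin_gauge z / S\<^sup>2) * (16 * (X / S\<^sup>2) * c ^ (l - 2))"
      by (simp add: power2_eq_square power4_eq_xxxx mult_ac)
    also have "\<dots> \<le> (real l)\<^sup>2 * 1 * (16 * (X / S\<^sup>2) * c ^ (l - 2))"
      using l2 g X c by (intro mult_mono) auto
    finally show ?thesis by (simp add: mult_ac)
  qed
  have a2: "real l * c ^ (l - 1) * (X * D) / S\<^sup>2 \<le> real l * D * (X / S\<^sup>2) * c ^ (l - 2)"
  proof -
    have "real l * c ^ (l - 1) * (X * D) / S\<^sup>2 = c ^ (l - 1) * (real l * D * (X / S\<^sup>2))"
      by simp
    also have "\<dots> \<le> c ^ (l - 2) * (real l * D * (X / S\<^sup>2))"
      using c1 X by (intro mult_right_mono) auto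
    finally show ?thesis by (simp add: mult_ac)
  qed
  have abs_diff_le: "0 \<le> a \<Longrightarrow> 0 \<le> b \<Longrightarrow> a \<le> a' \<Longrightarrow> b \<le> b' \<Longrightarrow> \<bar>a - b\<bar> \<le> a' + b'" for a b a' b' :: real
    by linarith
  have "0 \<le> real l * real (l - 1) * c ^ (l - 2) * (16 * X * grushin_gauge z) / S ^ 4"
    "0 \<le> real l * c ^ (l - 1) * (X * D) / S\<^sup>2"
    using X c by auto
  then have "\<bar>real l * real (l - 1) * c ^ (l - 2) * (16 * X * grushin_gauge z) / S ^ 4 - real l * c ^ (l - 1) * (X * D) / S\<^sup>2\<bar>
     \<le> 16 * (real l)\<^sup>2 * (X / S\<^sup>2) * c ^ (l - 2) + real l * D * (X / S\<^sup>2) * c ^ (l - 2)"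
    using a1 a2 by (rule abs_diff_le)
  then have "\<bar>grushin (test_bump l S T) z t\<bar> \<le> (16 * (real l)\<^sup>2 * (X / S\<^sup>2) * c ^ (l - 2) + real l * D * (X / S\<^sup>2) * c ^ (l - 2)) * s ^ (l - 2)"
    unfolding grushin_test_bump[OF assms(1)] abs_mult c_def[symmetric] s_def[symmetric] X_def[symmetric] D_def[symmetric]
    using s s1 X c by (intro mult_mono) auto
  also have "\<dots> = (16 * (real l)\<^sup>2 + real l * D) * (X / S\<^sup>2) * (c * s) ^ (l - 2)"
    by (simp only: power_mult_distrib ring_distribs mult_ac)
  also have "X / S\<^sup>2 = X / S / S"
    by (simp add: power2_eq_square)
  finally show ?thesis
    unfolding c_def[symmetric] s_def[symmetric] power2_norm_eq_inner X_def[symmetric] D_def[symmetric]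
    by (simp only: mult.assoc times_divide_eq_right)
qed

section \<open>Young's inequality and the lower bound for the memory term\<close>

text \<open>Whichever of b and \<open>K * a powr (p - 1)\<close> is larger, one summand alone
  already dominates the product. The constants are not the sharp ones, but the dependence on K is
  explicit, which is all that the later limits use.\<close>

lemma young_weighted:
  fixes a b K p :: real
  assumes "0 \<le> a" "0 \<le> b" "0 < K" "1 < p"
  shows "a * b \<le> K * a powr p + K powr (- 1 / (p - 1)) * b powr (p / (p - 1))"
proof (cases "b \<le> K * a powr (p - 1)")
  case True
  have "a * b \<le> a * (K * a powr (p - 1))"
    using True assms by (intro mult_left_mono)
  also have "\<dots> = K * a powr p"
    using assms by (cases "a = 0") (auto simp: powr_diff)
  finally show ?thesis
    by (smt (verit) assms mult_nonneg_nonneg powr_ge_zero)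
next
  case False
  then have b: "0 < b" and "a powr (p - 1) \<le> b / K"
    using assms by (auto simp: not_le field_simps intro: le_less_trans[rotated])
  then have "(a powr (p - 1)) powr (1 / (p - 1)) \<le> (b / K) powr (1 / (p - 1))"
    using assms by (intro powr_mono2) auto
  then have "a \<le> (b / K) powr (1 / (p - 1))"
    using assms by (simp add: powr_powr)
  then have "a * b \<le> (b / K) powr (1 / (p - 1)) * b"
    using b by simp
  also have "\<dots> = K powr (- 1 / (p - 1)) * (b powr (1 / (p - 1)) * b powr 1)"
    using assms b by (simp add: powr_divide powr_minus field_simps)
  also have "b powr (1 / (p - 1)) * b powr 1 = b powr (p / (p - 1))"
    using assms unfolding powr_add[symmetric] by (simp add: field_simps)
  finally show ?thesis
    by (smt (verit) assms mult_nonneg_nonneg powr_ge_zero)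
qed

lemma nn_integral_one_minus_power:
  fixes T s :: real
  assumes "0 < T" "s \<le> T" "1 \<le> l"
  shows "(\<integral>\<^sup>+t. ennreal ((1 - t / T) ^ (l - 1)) * indicator {s..T} t \<partial>lborel) = ennreal (T / l * (1 - s / T) ^ l)"
proof -
  have d: "((\<lambda>t. - (T / l) * (1 - t / T) ^ l) has_real_derivative (1 - x / T) ^ (l - 1)) (at x)" for x
  proof -
    have "((\<lambda>t. (1 - t / T) ^ l) has_real_derivative real l * (1 - x / T) ^ (l - 1) * (- (1 / T))) (at x)"
      using assms by (auto intro!: derivative_eq_intros)
    from DERIV_cmult[OF this, of "- (T / l)"] show ?thesis
      using assms by simp
  qed
  have "(\<integral>\<^sup>+t. ennreal ((1 - t / T) ^ (l - 1)) * indicator {s..T} t \<partial>lborel)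
    = ennreal (- (T / l) * (1 - T / T) ^ l - - (T / l) * (1 - s / T) ^ l)"
    using assms by (intro nn_integral_FTC_Icc d) (auto simp: divide_simps)
  then show ?thesis
    using assms by (simp add: power_0_left)
qed

text \<open>For the moving domain \<open>{0..t}\<close> of the memory integral, whose indicator has
  to be jointly measurable in s and t before the integrals are exchanged.\<close>

lemma pred_mem_atLeastAtMost [measurable (raw)]:
  fixes f g h :: "'a \<Rightarrow> real"
  assumes [measurable]: "f \<in> borel_measurable M" "g \<in> borel_measurable M" "h \<in> borel_measurable M"
  shows "Measurable.pred M (\<lambda>x. f x \<in> {g x..h x})"
  unfolding atLeastAtMost_iff by measurable

text \<open>
  The kernel is at least $T^{-\gamma}$ on $0<s<t<T$, so after exchanging the integrals only
  $\int_s^T(1-t/T)^{l-1}\,dt$ has to be computed.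
\<close>
lemma convolution_pairing_bound:
  fixes g :: "real \<Rightarrow> real"
  assumes [measurable]: "g \<in> borel_measurable borel" and g: "\<And>s. 0 \<le> g s"
    and "0 < \<gamma>" "0 < T" "2 \<le> l"
  shows "(\<integral>\<^sup>+s. ennreal (T powr (1 - \<gamma>) / l * (g s * (1 - s / T) ^ l)) * indicator {0<..<T} s \<partial>lborel)
    \<le> (\<integral>\<^sup>+t. ennreal ((1 - t / T) ^ (l - 1)) * indicator {0<..<T} t *
         (\<integral>\<^sup>+s. ennreal ((t - s) powr (- \<gamma>) * g s) * indicator {0..t} s \<partial>lborel) \<partial>lborel)"
proof -
  have 1: "ennreal (T powr (1 - \<gamma>) / l * (g s * (1 - s / T) ^ l)) * indicator {0<..<T} s
     \<le> (\<integral>\<^sup>+t. (ennreal ((1 - t / T) ^ (l - 1)) * indicator {0<..<T} t) *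
         (ennreal ((t - s) powr (- \<gamma>) * g s) * indicator {0..t} s) \<partial>lborel)" for s
  proof (cases "0 < s \<and> s < T")
    case True
    have "ennreal (T powr (1 - \<gamma>) / l * (g s * (1 - s / T) ^ l)) * indicator {0<..<T} s
       = ennreal (T powr (- \<gamma>) * g s) * ennreal (T / l * (1 - s / T) ^ l)"
    proof -
      have "T powr (1 - \<gamma>) / l * (g s * (1 - s / T) ^ l) = T powr (- \<gamma>) * g s * (T / l * (1 - s / T) ^ l)"
        using assms by (simp add: powr_diff powr_minus divide_inverse)
      moreover have "ennreal (T powr (- \<gamma>) * g s * (T / l * (1 - s / T) ^ l)) = ennreal (T powr (- \<gamma>) * g s) * ennreal (T / l * (1 - s / T) ^ l)"
        using True assms by (intro ennreal_mult) auto
      ultimately show ?thesis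
        using True by (simp only: indicator_simps(1) greaterThanLessThan_iff mult_1_right simp_thms)
    qed
    also have "\<dots> = ennreal (T powr (- \<gamma>) * g s) *
        (\<integral>\<^sup>+t. ennreal ((1 - t / T) ^ (l - 1)) * indicator {s..T} t \<partial>lborel)"
      using True assms by (subst nn_integral_one_minus_power) auto
    also have "\<dots> = (\<integral>\<^sup>+t. ennreal (T powr (- \<gamma>) * g s) *
        (ennreal ((1 - t / T) ^ (l - 1)) * indicator {s..T} t) \<partial>lborel)"
      by (rule nn_integral_cmult[symmetric]) measurable
    also have "\<dots> \<le> (\<integral>\<^sup>+t. (ennreal ((1 - t / T) ^ (l - 1)) * indicator {0<..<T} t) *
         (ennreal ((t - s) powr (- \<gamma>) * g s) * indicator {0..t} s) \<partial>lborel)"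
    proof (rule nn_integral_mono_AE)
      \<comment> \<open>The point t = s must be excluded: \<open>0 powr (- \<gamma>) = 0\<close>, so
        the kernel vanishes there instead of being infinite.\<close>
      have "AE t in lborel. t \<noteq> s \<and> t \<noteq> T"
        using AE_lborel_singleton by auto
      then show "AE t in lborel. ennreal (T powr (- \<gamma>) * g s) *
          (ennreal ((1 - t / T) ^ (l - 1)) * indicator {s..T} t)
        \<le> (ennreal ((1 - t / T) ^ (l - 1)) * indicator {0<..<T} t) *
         (ennreal ((t - s) powr (- \<gamma>) * g s) * indicator {0..t} s)"
      proof eventually_elim
        case (elim t)
        show ?case
        proof (cases "s < t \<and> t < T")
          case in_range: True
          have "T powr (- \<gamma>) \<le> (t - s) powr (- \<gamma>)"
            using in_range True assms by (intro powr_mono2') auto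
          then have "ennreal (T powr (- \<gamma>) * g s) \<le> ennreal ((t - s) powr (- \<gamma>) * g s)"
            using g by (intro ennreal_leI mult_right_mono)
          then have "ennreal (T powr (- \<gamma>) * g s) * ennreal ((1 - t / T) ^ (l - 1))
              \<le> ennreal ((t - s) powr (- \<gamma>) * g s) * ennreal ((1 - t / T) ^ (l - 1))"
            by (rule mult_right_mono) simp
          moreover have "indicator {s..T} t = (1::ennreal)" "indicator {0<..<T} t = (1::ennreal)" "indicator {0..t} s = (1::ennreal)"
            using in_range True by auto
          ultimately show ?thesis
            by (simp only: mult_1_right mult_1_left mult.commute)
        next
          case False
          then show ?thesis
            using elim by (auto simp: indicator_def)
        qed
      qed
    qed
    finally show ?thesis .
  qed auto
  have "(\<integral>\<^sup>+s. ennreal (T powr (1 - \<gamma>) / l * (g s * (1 - s / T) ^ l)) * indicator {0<..<T} s \<partial>lborel)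
    \<le> (\<integral>\<^sup>+s. \<integral>\<^sup>+t. (ennreal ((1 - t / T) ^ (l - 1)) * indicator {0<..<T} t) *
         (ennreal ((t - s) powr (- \<gamma>) * g s) * indicator {0..t} s) \<partial>lborel \<partial>lborel)"
    by (intro nn_integral_mono 1)
  also have "\<dots> = (\<integral>\<^sup>+t. \<integral>\<^sup>+s. (ennreal ((1 - t / T) ^ (l - 1)) * indicator {0<..<T} t) *
         (ennreal ((t - s) powr (- \<gamma>) * g s) * indicator {0..t} s) \<partial>lborel \<partial>lborel)"
    by (rule lborel_pair.Fubini') measurable
  also have "\<dots> = (\<integral>\<^sup>+t. ennreal ((1 - t / T) ^ (l - 1)) * indicator {0<..<T} t *
         (\<integral>\<^sup>+s. ennreal ((t - s) powr (- \<gamma>) * g s) * indicator {0..t} s \<partial>lborel) \<partial>lborel)"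
    by (intro nn_integral_cong nn_integral_cmult) measurable
  finally show ?thesis .
qed

text \<open>Local integrability is the source of measurability: u is measurable on each set of a
  compact exhaustion of the open strip, and the truncations are eventually constant at every point.
  The margin T/(n+2) keeps the compact sets away from both ends of the time interval.\<close>

lemma measurable_on_strip:
  fixes u :: "(real^'n) \<times> (real^'k) \<Rightarrow> real \<Rightarrow> real"
  assumes "loc_int T u" "0 < T"
  shows "(\<lambda>w. indicator (UNIV \<times> {0<..<T}) w * u (fst w) (snd w)) \<in> borel_measurable borel"
proof -
  define K where "K n = cball (0 :: (real^'n) \<times> (real^'k)) (real n) \<times> {T / (real n + 2) .. T - T / (real n + 2)}" for n :: nat
  have "compact (K n)" for n
    unfolding K_def by (intro compact_Times) auto
  moreover have "K n \<subseteq> UNIV \<times> {0<..<T}" for n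
  proof -
    have "0 < T / (real n + 2)" using assms by simp
    then show ?thesis unfolding K_def by auto
  qed
  ultimately have "set_integrable lborel (K n) (\<lambda>(z, t). u z t)" for n
    using assms unfolding loc_int_def by blast
  then have "(\<lambda>w. indicator (K n) w * u (fst w) (snd w)) \<in> borel_measurable borel" for n
    unfolding set_integrable_def using borel_measurable_integrable by (fastforce simp: case_prod_beta)
  moreover have "(\<lambda>n. indicator (K n) w * u (fst w) (snd w)) \<longlonglongrightarrow> indicator (UNIV \<times> {0<..<T}) w * u (fst w) (snd w)" for w
  proof (cases "snd w \<in> {0<..<T}")
    case True
    have l: "(\<lambda>n. T / (real n + 2)) \<longlonglongrightarrow> 0" using LIMSEQ_ignore_initial_segment[OF lim_const_over_n[of T], of 2] by (simp add: add.commute)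
    have "\<forall>\<^sub>F n in sequentially. T / (real n + 2) < min (snd w) (T - snd w)"
      using order_tendstoD(2)[OF l, of "min (snd w) (T - snd w)"] True by auto
    moreover have "\<forall>\<^sub>F n in sequentially. norm (fst w) \<le> real n"
      by (rule eventually_sequentiallyI[of "nat \<lceil>norm (fst w)\<rceil>"]) linarith
    ultimately have "\<forall>\<^sub>F n in sequentially. w \<in> K n"
      by eventually_elim (cases w; auto simp: K_def)
    then have "\<forall>\<^sub>F n in sequentially. indicator (K n) w * u (fst w) (snd w) = indicator (UNIV \<times> {0<..<T}) w * u (fst w) (snd w)"
      by eventually_elim (use True in \<open>cases w; auto simp: indicator_def\<close>)
    then show ?thesis
      by (rule tendsto_eventually)
  next
    case False
    then have "w \<notin> K n" for n
      using \<open>K n \<subseteq> _\<close> by (cases w) auto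
    then show ?thesis
      using False by (cases w) auto
  qed
  ultimately show ?thesis
    by (rule borel_measurable_LIMSEQ_real[rotated])
qed

lemma measurable_cutoff [measurable]:
  "cutoff S \<in> borel_measurable (borel :: (('a::euclidean_space) \<times> ('b::euclidean_space)) measure)"
  using continuous_on_cutoff[OF continuous_on_id] by (intro borel_measurable_continuous_onI) simp

lemma borel_measurable_fst_comp:
  fixes f :: "'c \<Rightarrow> 'a::topological_space \<times> 'b::topological_space"
  assumes "f \<in> borel_measurable M"
  shows "(\<lambda>x. fst (f x)) \<in> borel_measurable M"
  using measurable_compose[OF assms borel_measurable_continuous_onI[OF continuous_on_fst[OF continuous_on_id]]] .

lemma borel_measurable_snd_comp:
  fixes f :: "'c \<Rightarrow> 'a::topological_space \<times> 'b::topological_space"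
  assumes "f \<in> borel_measurable M"
  shows "(\<lambda>x. snd (f x)) \<in> borel_measurable M"
  using measurable_compose[OF assms borel_measurable_continuous_onI[OF continuous_on_snd[OF continuous_on_id]]] .

lemma nn_integral_lborel_prod:
  fixes f :: "'a::euclidean_space \<times> 'b::euclidean_space \<Rightarrow> ennreal"
  assumes "f \<in> borel_measurable (lborel \<Otimes>\<^sub>M lborel)"
  shows "(\<integral>\<^sup>+w. f w \<partial>lborel) = (\<integral>\<^sup>+z. \<integral>\<^sup>+s. f (z, s) \<partial>lborel \<partial>lborel)"
  using lborel.nn_integral_fst[OF assms] by (simp add: lborel_prod)

text \<open>The estimate runs in \<open>ennreal\<close>, so Tonelli applies before any integrability
  is known. A weak solution has an integrable pairing of its memory with the test function; that
  finite upper bound then yields integrability of u^p times the weight as a conclusion.\<close>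

lemma memory_pairing_bound:
  fixes u :: "(real^'n) \<times> (real^'k) \<Rightarrow> real \<Rightarrow> real"
  assumes par: "0 < \<gamma>" "1 < p" "0 < T" "0 < S" "3 \<le> l"
    and nonneg: "\<forall>z t. t > 0 \<longrightarrow> 0 \<le> u z t"
    and sol: "weak_solution \<gamma> p u0 T u"
  defines "F \<equiv> \<lambda>w. indicator (UNIV \<times> {0<..<T}) w * (u (fst w) (snd w) powr p * (cutoff S (fst w) * (1 - snd w / T)) ^ l)"
  shows "integrable lborel F"
    and "T powr (1 - \<gamma>) / l * (LINT w|lborel. F w) \<le>
      (LINT w:UNIV \<times> {0<..<T}|lborel. memory \<gamma> p u (fst w) (snd w) * test_bump l S T (fst w) (snd w))"
proof -
  define A :: "((real^'n) \<times> (real^'k)) \<times> real \<Rightarrow> real" where "A = indicator (UNIV \<times> {0<..<T})"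
  \<comment> \<open>u is controlled only for times strictly inside (0,T); cutting it off there gives
    a function measurable and nonnegative everywhere.\<close>
  define U where "U w = A w * u (fst w) (snd w)" for w
  have [measurable]: "A \<in> borel_measurable borel"
    unfolding A_def by (intro borel_measurable_indicator borel_open open_Times) auto
  have U [measurable]: "U \<in> borel_measurable borel"
    using measurable_on_strip[of T u] sol par unfolding U_def A_def weak_solution_def by auto
  have U0: "0 \<le> U w" for w
    using nonneg by (cases w) (auto simp: U_def A_def indicator_def)
  define h where "h w = U w powr p" for w
  have h0: "0 \<le> h w" for w by (simp add: h_def)
  have [measurable]: "h \<in> borel_measurable borel" unfolding h_def by measurable
  have h_eq: "\<bar>u z s\<bar> powr (p - 1) * u z s = h (z, s)" if "0 < s" "s < T" for z s
    using that nonneg[rule_format, of s z] par by (cases "u z s = 0") (auto simp: h_def U_def A_def powr_diff)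
  let ?bump = "\<lambda>w. test_bump l S T (fst w) (snd w)"
  let ?M = "\<lambda>w. A w * (memory \<gamma> p u (fst w) (snd w) * ?bump w)"
  have intM: "integrable lborel ?M"
    using sol test_fun_test_bump[OF par(5,3,4)] unfolding weak_solution_def set_integrable_def A_def
    by (auto simp: case_prod_beta)
  define J where "J z t = (\<integral>\<^sup>+s. ennreal ((t - s) powr (- \<gamma>) * h (z, s)) * indicator {0..t} s \<partial>lborel)" for z t
  have bump0: "0 \<le> ?bump w" if "A w \<noteq> 0" for w
    using that par by (auto simp: test_bump_def A_def indicator_def split: if_splits)
  \<comment> \<open>A Bochner integral defaults to 0 where its integrand is not integrable. The
    almost-everywhere clause of \<open>weak_solution\<close> rules this out, so
    \<open>memory\<close> agrees almost everywhere with the nonnegative integral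
    \<open>J\<close>.\<close>
  have ae: "AE w in lborel. A w \<noteq> 0 \<longrightarrow> ennreal (memory \<gamma> p u (fst w) (snd w)) = J (fst w) (snd w) \<and>
      0 \<le> memory \<gamma> p u (fst w) (snd w)"
  proof -
    have "AE w in lborel. w \<in> UNIV \<times> {0<..<T} \<longrightarrow>
        set_integrable lborel {0..snd w}
          (\<lambda>s. (snd w - s) powr (- \<gamma>) * (\<bar>u (fst w) s\<bar> powr (p - 1) * u (fst w) s))"
      using sol unfolding weak_solution_def by blast
    then show ?thesis
    proof eventually_elim
      case (elim w)
      show ?case
      proof
        assume "A w \<noteq> 0"
        then have w: "0 < snd w" "snd w < T" "w \<in> UNIV \<times> {0<..<T}"
          by (auto simp: A_def indicator_def split: if_splits)
        let ?f = "\<lambda>s. indicator {0..snd w} s *\<^sub>R ((snd w - s) powr (- \<gamma>) * (\<bar>u (fst w) s\<bar> powr (p - 1) * u (fst w) s))"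
        have int: "integrable lborel ?f"
          using elim w unfolding set_integrable_def by blast
        \<comment> \<open>At s = 0 the value of u is unconstrained while \<open>h\<close> is 0, so
          this null set is left out.\<close>
        have ae0: "AE s in lborel. s \<noteq> (0::real)"
          by (rule AE_lborel_singleton)
        have eq: "AE s in lborel. 0 \<le> ?f s \<and> ennreal (?f s) = ennreal ((snd w - s) powr (- \<gamma>) * h (fst w, s)) * indicator {0..snd w} s"
          using ae0
        proof eventually_elim
          case (elim s)
          show ?case
          proof (cases "s \<in> {0..snd w}")
            case True
            then have "0 < s" "s < T" using elim w by auto
            then show ?thesis using h_eq[of s "fst w"] True h0 by simp
          qed simp
        qed
        have m: "memory \<gamma> p u (fst w) (snd w) = integral\<^sup>L lborel ?f"
          by (simp add: memory_def set_lebesgue_integral_def)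
        have "(\<integral>\<^sup>+s. ennreal (?f s) \<partial>lborel) = ennreal (integral\<^sup>L lborel ?f)"
          using eq by (intro nn_integral_eq_integral int) auto
        moreover have "(\<integral>\<^sup>+s. ennreal (?f s) \<partial>lborel) = J (fst w) (snd w)"
          unfolding J_def using eq by (intro nn_integral_cong_AE) auto
        moreover have "0 \<le> integral\<^sup>L lborel ?f"
          using eq by (intro integral_nonneg_AE) auto
        ultimately show "ennreal (memory \<gamma> p u (fst w) (snd w)) = J (fst w) (snd w) \<and> 0 \<le> memory \<gamma> p u (fst w) (snd w)"
          unfolding m by simp
      qed
    qed
  qed
  have F_eq: "F w = A w * (h w * (cutoff S (fst w) * (1 - snd w / T)) ^ l)" for w
    by (cases "A w = 0") (auto simp: F_def h_def U_def A_def indicator_def split: if_splits)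
  have F0: "0 \<le> F w" for w
    using par by (auto simp: F_def indicator_def split: if_splits)
  have [measurable]: "F \<in> borel_measurable borel"
  proof -
    note [measurable (raw)] = borel_measurable_fst_comp borel_measurable_snd_comp
    show ?thesis unfolding F_eq by measurable
  qed
  have pos: "0 < T powr (1 - \<gamma>) / l" using par by simp
  have "(\<integral>\<^sup>+w. ennreal (T powr (1 - \<gamma>) / l * F w) \<partial>lborel)
     = (\<integral>\<^sup>+z. \<integral>\<^sup>+s. ennreal (T powr (1 - \<gamma>) / l * F (z, s)) \<partial>lborel \<partial>lborel)"
    by (rule nn_integral_lborel_prod) (simp add: lborel_prod)
  also have "\<dots> \<le> (\<integral>\<^sup>+z. ennreal (cutoff S z ^ l) * (\<integral>\<^sup>+t. ennreal ((1 - t / T) ^ (l - 1)) * indicator {0<..<T} t * J z t \<partial>lborel) \<partial>lborel)"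
  proof (rule nn_integral_mono)
    fix z :: "(real^'n) \<times> (real^'k)"
    have "(\<integral>\<^sup>+s. ennreal (T powr (1 - \<gamma>) / l * F (z, s)) \<partial>lborel)
      = (\<integral>\<^sup>+s. ennreal (cutoff S z ^ l) * (ennreal (T powr (1 - \<gamma>) / l * (h (z, s) * (1 - s / T) ^ l)) * indicator {0<..<T} s) \<partial>lborel)"
    proof (rule nn_integral_cong)
      fix s :: real
      show "ennreal (T powr (1 - \<gamma>) / l * F (z, s)) = ennreal (cutoff S z ^ l) * (ennreal (T powr (1 - \<gamma>) / l * (h (z, s) * (1 - s / T) ^ l)) * indicator {0<..<T} s)"
      proof (cases "s \<in> {0<..<T}")
        case True
        then have "T powr (1 - \<gamma>) / l * F (z, s) = cutoff S z ^ l * (T powr (1 - \<gamma>) / l * (h (z, s) * (1 - s / T) ^ l))"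
          by (simp add: F_eq A_def power_mult_distrib)
        moreover have "ennreal (cutoff S z ^ l * (T powr (1 - \<gamma>) / l * (h (z, s) * (1 - s / T) ^ l)))
          = ennreal (cutoff S z ^ l) * ennreal (T powr (1 - \<gamma>) / l * (h (z, s) * (1 - s / T) ^ l))"
          using True par h0 by (intro ennreal_mult) auto
        ultimately show ?thesis
          using True by (simp only: indicator_simps(1) mult_1_right)
      qed (simp add: F_eq A_def)
    qed
    also have "\<dots> = ennreal (cutoff S z ^ l) * (\<integral>\<^sup>+s. ennreal (T powr (1 - \<gamma>) / l * (h (z, s) * (1 - s / T) ^ l)) * indicator {0<..<T} s \<partial>lborel)"
      by (rule nn_integral_cmult) measurable
    also have "\<dots> \<le> ennreal (cutoff S z ^ l) * (\<integral>\<^sup>+t. ennreal ((1 - t / T) ^ (l - 1)) * indicator {0<..<T} t * J z t \<partial>lborel)"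
      unfolding J_def using par h0 by (intro mult_left_mono convolution_pairing_bound) auto
    finally show "(\<integral>\<^sup>+s. ennreal (T powr (1 - \<gamma>) / l * F (z, s)) \<partial>lborel) \<le> \<dots>" .
  qed
  also have "\<dots> = (\<integral>\<^sup>+z. \<integral>\<^sup>+t. ennreal (cutoff S z ^ l) * (ennreal ((1 - t / T) ^ (l - 1)) * indicator {0<..<T} t * J z t) \<partial>lborel \<partial>lborel)"
    unfolding J_def by (intro nn_integral_cong nn_integral_cmult[symmetric]) measurable
  also have "\<dots> = (\<integral>\<^sup>+w. ennreal (cutoff S (fst w) ^ l) * (ennreal ((1 - snd w / T) ^ (l - 1)) * indicator {0<..<T} (snd w) * J (fst w) (snd w)) \<partial>lborel)"
  proof -
    have "(\<lambda>w. ennreal (cutoff S (fst w) ^ l) * (ennreal ((1 - snd w / T) ^ (l - 1)) * indicator {0<..<T} (snd w) * J (fst w) (snd w)))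
        \<in> borel_measurable (lborel \<Otimes>\<^sub>M lborel)"
      unfolding J_def by measurable
    then show ?thesis
      by (subst nn_integral_lborel_prod) auto
  qed
  also have "\<dots> = (\<integral>\<^sup>+w. ennreal (?M w) \<partial>lborel)"
    using ae
  proof (intro nn_integral_cong_AE, eventually_elim)
    case (elim w)
    show ?case
    proof (cases "snd w \<in> {0<..<T}")
      case True
      then have "A w = 1" by (cases w) (auto simp: A_def)
      then show ?thesis
        using elim True par by (simp add: test_bump_def ennreal_mult mult_ac)
    next
      case False
      then show ?thesis by (cases w) (auto simp: A_def)
    qed
  qed
  also have "\<dots> = ennreal (LINT w|lborel. ?M w)"
  proof (rule nn_integral_eq_integral[OF intM])
    show "AE w in lborel. 0 \<le> ?M w"
      using ae by eventually_elim (use bump0 in \<open>auto simp: A_def indicator_def split: if_splits\<close>)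
  qed
  finally have *: "(\<integral>\<^sup>+w. ennreal (T powr (1 - \<gamma>) / l * F w) \<partial>lborel) \<le> ennreal (LINT w|lborel. ?M w)" .
  have intF: "integrable lborel (\<lambda>w. T powr (1 - \<gamma>) / l * F w)"
    using * F0 pos by (intro integrableI_nonneg) (auto simp: le_less_trans)
  then show "integrable lborel F"
    using pos by (metis integrable_mult_left_iff less_irrefl)
  have M0: "0 \<le> (LINT w|lborel. ?M w)"
    using ae by (intro integral_nonneg_AE, eventually_elim) (use bump0 in \<open>auto simp: A_def indicator_def split: if_splits\<close>)
  have "(\<integral>\<^sup>+w. ennreal (T powr (1 - \<gamma>) / l * F w) \<partial>lborel) = ennreal (LINT w|lborel. T powr (1 - \<gamma>) / l * F w)"
  proof (rule nn_integral_eq_integral[OF intF], rule AE_I2)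
    show "0 \<le> T powr (1 - \<gamma>) / l * F w" for w
      using F0[of w] pos by (intro mult_nonneg_nonneg) auto
  qed
  with * have "ennreal (LINT w|lborel. T powr (1 - \<gamma>) / l * F w) \<le> ennreal (LINT w|lborel. ?M w)"
    by (simp only:)
  then have "(LINT w|lborel. T powr (1 - \<gamma>) / l * F w) \<le> (LINT w|lborel. ?M w)"
    using M0 by (simp only: ennreal_le_iff)
  then have "T powr (1 - \<gamma>) / l * (LINT w|lborel. F w) \<le> (LINT w|lborel. ?M w)"
    by (simp only: integral_mult_right_zero)
  then show "T powr (1 - \<gamma>) / l * (LINT w|lborel. F w) \<le>
      (LINT w:UNIV \<times> {0<..<T}|lborel. memory \<gamma> p u (fst w) (snd w) * ?bump w)"
    by (simp only: set_lebesgue_integral_def A_def real_scaleR_def)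
qed

section \<open>The energy inequality at fixed S and T\<close>

definition support_box :: "real \<Rightarrow> real \<Rightarrow> (('a::euclidean_space \<times> 'b::euclidean_space) \<times> real) set" where
  "support_box S T = (cball 0 (sqrt S) \<times> cball 0 S) \<times> {0..T}"

lemma measure_lborel_Times:
  fixes A :: "'a::euclidean_space set" and B :: "'b::euclidean_space set"
  assumes "A \<in> sets borel" "B \<in> sets borel"
  shows "measure lborel (A \<times> B) = measure lborel A * measure lborel B"
  using lborel.emeasure_pair_measure_Times[of A lborel B] assms
  by (simp add: lborel_prod measure_def enn2real_mult)

lemma integrable_indicator_support_box:
  "integrable lborel (indicator (support_box S T) :: (('a::euclidean_space \<times> 'b::euclidean_space) \<times> real) \<Rightarrow> real)"
proof -
  have "compact (support_box S T :: (('a \<times> 'b) \<times> real) set)"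
    unfolding support_box_def by (intro compact_Times) auto
  then show ?thesis
    using emeasure_bounded_finite[OF compact_imp_bounded] by (intro integrable_real_indicator) (auto simp: borel_compact)
qed

text \<open>The exponent is half the homogeneous dimension Q = N + 2k: a ball of radius
  \<open>sqrt S\<close> in x times a ball of radius \<open>S\<close> in y.\<close>

lemma measure_support_box:
  assumes "0 < S" "0 < T"
  shows "measure lborel (support_box S T :: (('a::euclidean_space \<times> 'b::euclidean_space) \<times> real) set)
    = unit_ball_vol DIM('a) * unit_ball_vol DIM('b) * S powr (DIM('a) / 2 + DIM('b)) * T"
proof -
  have "sqrt S ^ DIM('a) = S powr (DIM('a) / 2)"
    using assms by (simp add: powr_half_sqrt[symmetric] powr_power)
  moreover have "S ^ DIM('b) = S powr DIM('b)"
    using assms by (simp add: powr_realpow)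
  ultimately show ?thesis
    using assms unfolding support_box_def
    by (simp add: measure_lborel_Times content_cball powr_add borel_Times)
qed

text \<open>Independent of S and T, so that all dependence on the scales sits in the weight and
  monotone or dominated convergence can act on a fixed function.\<close>

definition power_density :: "real \<Rightarrow> ('z \<Rightarrow> real \<Rightarrow> real) \<Rightarrow> 'z \<times> real \<Rightarrow> real" where
  "power_density p u w = indicator (UNIV \<times> {0<..}) w * u (fst w) (snd w) powr p"

text \<open>Unlike the test function it is truncated in time, which replaces the indicator of t < T
  and makes it increase with S and T for t >= 0.\<close>

definition weight :: "nat \<Rightarrow> real \<Rightarrow> real \<Rightarrow> ('a::real_inner \<times> 'b::real_inner) \<times> real \<Rightarrow> real" where
  "weight l S T w = (cutoff S (fst w) * max 0 (1 - snd w / T)) ^ l"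

definition degeneracy :: "real \<Rightarrow> ('a::real_inner \<times> 'b::real_inner) \<times> real \<Rightarrow> real" where
  "degeneracy S w = (norm (fst (fst w)))\<^sup>2 / S"

lemma power_density_nonneg [simp]: "0 \<le> power_density p u w"
  by (simp add: power_density_def)

lemma weight_nonneg [simp]: "0 \<le> weight l S T w"
  by (simp add: weight_def)

lemma degeneracy_nonneg: "0 < S \<Longrightarrow> 0 \<le> degeneracy S w"
  by (simp add: degeneracy_def)

lemma cutoff_pos_imp_degeneracy_le_1:
  assumes "0 < S" "0 < cutoff S (fst w)"
  shows "degeneracy S w \<le> 1"
proof -
  have "(norm (fst (fst w)))\<^sup>2 \<le> (sqrt S)\<^sup>2"
    using cutoff_pos_imp(1)[OF assms] by (intro power_mono) auto
  then show ?thesis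
    using assms by (simp add: degeneracy_def)
qed

lemma weight_degeneracy_le:
  assumes "0 < S" "1 \<le> l"
  shows "weight l S T w * degeneracy S w \<le> weight l S T w"
proof (cases "0 < cutoff S (fst w)")
  case True
  then show ?thesis
    using cutoff_pos_imp_degeneracy_le_1[OF assms(1) True] weight_nonneg[of l S T w]
    by (simp add: mult_left_le)
next
  case False
  then have "cutoff S (fst w) = 0"
    using cutoff_nonneg[of S "fst w"] by linarith
  then show ?thesis
    using assms by (simp add: weight_def power_0_left)
qed

lemma measurable_weight [measurable]:
  "weight l S T \<in> borel_measurable (borel :: (('a::euclidean_space \<times> 'b::euclidean_space) \<times> real) measure)"
  unfolding weight_def
proof -
  note [measurable (raw)] = borel_measurable_fst_comp borel_measurable_snd_comp
  show "(\<lambda>w. (cutoff S (fst w) * max 0 (1 - snd w / T)) ^ l) \<in> borel_measurable (borel :: (('a \<times> 'b) \<times> real) measure)"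
    by measurable
qed

lemma measurable_degeneracy [measurable]:
  "degeneracy S \<in> borel_measurable (borel :: (('a::euclidean_space \<times> 'b::euclidean_space) \<times> real) measure)"
  unfolding degeneracy_def
  by (cases "S = 0") (auto intro!: borel_measurable_continuous_onI continuous_intros)

lemma power_density_weight_eq:
  assumes "0 < T" "1 \<le> l"
  shows "power_density p u w * weight l S T w = indicator (UNIV \<times> {0<..<T}) w *
    (u (fst w) (snd w) powr p * (cutoff S (fst w) * (1 - snd w / T)) ^ l)"
proof -
  consider "snd w \<le> 0" | "0 < snd w" "snd w < T" | "T \<le> snd w"
    by linarith
  then show ?thesis
  proof cases
    case 2
    then have "max 0 (1 - snd w / T) = 1 - snd w / T"
      using assms by simp
    then show ?thesis
      using 2 by (cases w) (simp add: power_density_def weight_def)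
  next
    case 3
    then have "max 0 (1 - snd w / T) = 0"
      using assms by simp
    then show ?thesis
      using 3 assms by (cases w) (simp add: power_density_def weight_def power_0_left)
  qed (cases w, simp add: power_density_def)
qed

text \<open>The weak formulation with both derivative terms moved to the right, the memory term
  being replaced by its lower bound. At time 0 the polynomial time factor is 1, so only the cutoff
  remains next to \<open>u0\<close>.\<close>

lemma test_bump_inequality:
  fixes u :: "(real^'n) \<times> (real^'k) \<Rightarrow> real \<Rightarrow> real"
  assumes par: "0 < \<gamma>" "1 < p" "0 < T" "0 < S" "3 \<le> l"
    and nonneg: "\<forall>z t. t > 0 \<longrightarrow> 0 \<le> u z t"
    and sol: "weak_solution \<gamma> p u0 T u"
  defines "R \<equiv> \<lambda>w. indicator (UNIV \<times> {0<..<T}) w * (- (u (fst w) (snd w) * grushin (test_bump l S T) (fst w) (snd w))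
      - u (fst w) (snd w) * dtime (test_bump l S T) (fst w) (snd w))"
  shows "integrable lborel (\<lambda>w. power_density p u w * weight l S T w)"
    and "integrable lborel R"
    and "T powr (1 - \<gamma>) / l * (LINT w|lborel. power_density p u w * weight l S T w)
      + (LINT z|lborel. u0 z * cutoff S z ^ l) \<le> (LINT w|lborel. R w)"
proof -
  have l: "1 \<le> l" using par by simp
  note mp = memory_pairing_bound[OF par nonneg sol, folded power_density_weight_eq[OF par(3) l]]
  show "integrable lborel (\<lambda>w. power_density p u w * weight l S T w)"
    by (rule mp(1))
  let ?A = "UNIV \<times> {0<..<T} :: (((real^'n) \<times> (real^'k)) \<times> real) set"
  let ?b = "test_bump l S T :: (real^'n) \<times> (real^'k) \<Rightarrow> real \<Rightarrow> real"
  have G: "set_integrable lborel ?A (\<lambda>w. u (fst w) (snd w) * grushin ?b (fst w) (snd w))"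
    and D: "set_integrable lborel ?A (\<lambda>w. u (fst w) (snd w) * dtime ?b (fst w) (snd w))"
    and eq: "- (LINT z|lborel. u0 z * ?b z 0)
          = (LINT w:?A|lborel. memory \<gamma> p u (fst w) (snd w) * ?b (fst w) (snd w))
          + (LINT w:?A|lborel. u (fst w) (snd w) * grushin ?b (fst w) (snd w))
          + (LINT w:?A|lborel. u (fst w) (snd w) * dtime ?b (fst w) (snd w))"
    using sol[unfolded weak_solution_def, THEN conjunct2, THEN conjunct2, THEN conjunct2, rule_format,
      OF test_fun_test_bump[OF par(5,3,4)], unfolded case_prod_beta] by blast+
  have R: "R = (\<lambda>w. - (indicator ?A w *\<^sub>R (u (fst w) (snd w) * grushin ?b (fst w) (snd w)))
     - indicator ?A w *\<^sub>R (u (fst w) (snd w) * dtime ?b (fst w) (snd w)))"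
    by (auto simp: R_def fun_eq_iff indicator_def)
  show "integrable lborel R"
    unfolding R using G D unfolding set_integrable_def by (intro Bochner_Integration.integrable_diff integrable_minus)
  have "(LINT w|lborel. R w) = - (LINT w:?A|lborel. u (fst w) (snd w) * grushin ?b (fst w) (snd w))
      - (LINT w:?A|lborel. u (fst w) (snd w) * dtime ?b (fst w) (snd w))"
    unfolding R set_lebesgue_integral_def
    using G D unfolding set_integrable_def by (subst Bochner_Integration.integral_diff) auto
  moreover have "?b z 0 = cutoff S z ^ l" for z
    by (simp add: test_bump_def)
  ultimately show "T powr (1 - \<gamma>) / l * (LINT w|lborel. power_density p u w * weight l S T w)
      + (LINT z|lborel. u0 z * cutoff S z ^ l) \<le> (LINT w|lborel. R w)"
    using eq mp(2) by simp
qed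

text \<open>The coefficient from the bound on the Grushin operator of the test function; the type
  arguments serve only to carry the dimensions N and k.\<close>

definition grushin_const :: "'n itself \<Rightarrow> 'k itself \<Rightarrow> nat \<Rightarrow> real" where
  "grushin_const _ _ l = 16 * (real l)\<^sup>2 + real l * (8 + 4 * real CARD('n) + 8 * real CARD('k))"

lemma test_bump_pointwise_bound:
  fixes u :: "(real^'n) \<times> (real^'k) \<Rightarrow> real \<Rightarrow> real"
  assumes par: "1 < p" "0 < T" "0 < S" "3 \<le> l" "real l / p \<le> real (l - 2)" "0 < K1" "0 < K2"
    and nonneg: "\<forall>z t. t > 0 \<longrightarrow> 0 \<le> u z t"
  defines "C \<equiv> grushin_const TYPE('n) TYPE('k) l"
  shows "indicator (UNIV \<times> {0<..<T}) w * (- (u (fst w) (snd w) * grushin (test_bump l S T) (fst w) (snd w))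
      - u (fst w) (snd w) * dtime (test_bump l S T) (fst w) (snd w))
    \<le> K1 * (power_density p u w * weight l S T w) + K2 * (power_density p u w * weight l S T w * degeneracy S w)
      + (K1 powr (- 1 / (p - 1)) * (l / T) powr (p / (p - 1)) + K2 powr (- 1 / (p - 1)) * (C / S) powr (p / (p - 1)))
        * indicator (support_box S T) w"
    (is "?L \<le> ?R")
proof -
  define z t where "z = fst w" and "t = snd w"
  have w: "w = (z, t)" by (simp add: z_def t_def)
  have C: "0 \<le> C" unfolding C_def grushin_const_def by auto
  have R0: "0 \<le> ?R"
    using par degeneracy_nonneg[OF par(3), of w] by (intro add_nonneg_nonneg mult_nonneg_nonneg) auto
  show ?thesis
  proof (cases "0 < t \<and> t < T \<and> 0 < cutoff S z")
    case False
    then have "?L = 0"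
    proof (cases "0 < t \<and> t < T")
      case True
      then have "cutoff S z = 0"
        using False cutoff_nonneg[of S z] by linarith
      then have "grushin (test_bump l S T) z t = 0" "dtime (test_bump l S T) z t = 0"
        using par by (auto simp: grushin_test_bump dtime_test_bump power_0_left)
      then show ?thesis
        by (simp add: w)
    qed (simp add: w)
    then show ?thesis
      using R0 by (rule ord_eq_le_trans)
  next
    case True
    define c s U e where "c = cutoff S z" and "s = 1 - t / T" and "U = u z t" and "e = degeneracy S w"
    have c: "0 < c" "c \<le> 1" using True by (auto simp: c_def)
    have s: "0 < s" "s \<le> 1" using True par by (auto simp: s_def)
    have U: "0 \<le> U" using nonneg[rule_format, of t z] True by (simp add: U_def)
    have e: "0 \<le> e" "e \<le> 1"
      using degeneracy_nonneg[OF par(3), of w] cutoff_pos_imp_degeneracy_le_1[OF par(3), of w] True by (auto simp: e_def z_def)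
    \<comment> \<open>Chosen so that \<open>a powr p\<close> is u^p times the weight. Since
      \<open>c * s\<close> is at most 1, the condition \<open>real l / p \<le> real (l - 2)\<close>
      makes \<open>a\<close> dominate u times the power l-2 left by the derivatives.\<close>
    define a where "a = U * (c * s) powr (l / p)"
    have a0: "0 \<le> a" using U by (simp add: a_def)
    have "(c * s) ^ (l - 2) = (c * s) powr real (l - 2)"
      using c s by (simp add: powr_realpow)
    also have "\<dots> \<le> (c * s) powr (l / p)"
      using c s par by (intro powr_mono') (auto simp: mult_le_one)
    finally have cs: "U * (c * s) ^ (l - 2) \<le> a"
      unfolding a_def using U by (intro mult_left_mono)
    have ap: "a powr p = power_density p u w * weight l S T w"
      using True c s U par
      by (simp add: a_def power_density_def weight_def w powr_mult powr_powr powr_realpow power_mult_distrib c_def[symmetric] s_def[symmetric] U_def[symmetric])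
    have box: "w \<in> support_box S T"
      using True cutoff_pos_imp[OF par(3), of z] by (auto simp: support_box_def w mem_Times_iff)
    have g: "- (U * grushin (test_bump l S T) z t) \<le> e * (a * (C / S))"
    proof -
      have "- (U * grushin (test_bump l S T) z t) \<le> U * \<bar>grushin (test_bump l S T) z t\<bar>"
        using U by (metis abs_ge_minus_self minus_mult_right mult_left_mono)
      also have "\<dots> \<le> U * (C * e / S * (c * s) ^ (l - 2))"
        using abs_grushin_test_bump_le[of l S T t z] True par U
        by (intro mult_left_mono) (auto simp: C_def grushin_const_def e_def degeneracy_def c_def s_def w)
      also have "\<dots> = e * ((U * (c * s) ^ (l - 2)) * (C / S))"
        by simp
      also have "\<dots> \<le> e * (a * (C / S))"
        using cs e C par by (intro mult_left_mono mult_right_mono) auto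
      finally show ?thesis .
    qed
    have d: "- (U * dtime (test_bump l S T) z t) \<le> a * (l / T)"
    proof -
      have "- (U * dtime (test_bump l S T) z t) = (real (l - 1) / T) * (U * (c ^ l * s ^ (l - 2)))"
        using par by (simp add: dtime_test_bump c_def s_def)
      also have "\<dots> \<le> (real l / T) * (U * (c * s) ^ (l - 2))"
        using par U c s unfolding power_mult_distrib
        by (intro mult_mono divide_right_mono power_decreasing) auto
      also have "\<dots> \<le> (real l / T) * a"
        using cs par by (intro mult_left_mono) auto
      finally show ?thesis by (simp add: mult.commute)
    qed
    have "a * (l / T) \<le> K1 * a powr p + K1 powr (- 1 / (p - 1)) * (l / T) powr (p / (p - 1))"
      using a0 par by (intro young_weighted) auto
    moreover have "e * (a * (C / S)) \<le> e * (K2 * a powr p + K2 powr (- 1 / (p - 1)) * (C / S) powr (p / (p - 1)))"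
      using a0 par C e by (intro mult_left_mono young_weighted) auto
    \<comment> \<open>The factor \<open>e\<close> is dropped only from the constant part; next to
      \<open>a powr p\<close> it stays, because its decay is used there.\<close>
    moreover have "e * (K2 powr (- 1 / (p - 1)) * (C / S) powr (p / (p - 1))) \<le> 1 * (K2 powr (- 1 / (p - 1)) * (C / S) powr (p / (p - 1)))"
      using e by (intro mult_right_mono) auto
    ultimately have "- (U * grushin (test_bump l S T) z t) - U * dtime (test_bump l S T) z t \<le>
       K1 * a powr p + K2 * (a powr p * e) +
       (K1 powr (- 1 / (p - 1)) * (l / T) powr (p / (p - 1)) + K2 powr (- 1 / (p - 1)) * (C / S) powr (p / (p - 1)))"
      using g d by (simp add: algebra_simps)
    moreover have "?L = - (U * grushin (test_bump l S T) z t) - U * dtime (test_bump l S T) z t"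
      using True by (simp add: w U_def)
    ultimately show ?thesis
      using box by (simp add: ap e_def)
  qed
qed

lemma measurable_power_density:
  fixes u :: "(real^'n) \<times> (real^'k) \<Rightarrow> real \<Rightarrow> real"
  assumes "\<And>T. 0 < T \<Longrightarrow> loc_int T u"
  shows "power_density p u \<in> borel_measurable borel"
proof -
  let ?I = "\<lambda>n. indicator (UNIV \<times> {0<..<real (Suc n)}) :: ((real^'n) \<times> (real^'k)) \<times> real \<Rightarrow> real"
  have [measurable]: "(\<lambda>w. ?I n w * u (fst w) (snd w)) \<in> borel_measurable borel" for n
    using assms by (intro measurable_on_strip) auto
  have "(\<lambda>n. (?I n w * u (fst w) (snd w)) powr p) \<longlonglongrightarrow> power_density p u w" for w
  proof (rule tendsto_eventually)
    have "\<forall>\<^sub>F n in sequentially. snd w < real (Suc n)"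
      by (rule eventually_sequentiallyI[of "nat \<lceil>snd w\<rceil>"]) linarith
    then show "\<forall>\<^sub>F n in sequentially. (?I n w * u (fst w) (snd w)) powr p = power_density p u w"
      by eventually_elim (cases w, auto simp: power_density_def indicator_def)
  qed
  then show ?thesis
    by (rule borel_measurable_LIMSEQ_real) measurable
qed

lemma energy_inequality:
  fixes u :: "(real^'n) \<times> (real^'k) \<Rightarrow> real \<Rightarrow> real"
  assumes par: "0 < \<gamma>" "1 < p" "0 < T" "0 < S" "3 \<le> l" "real l / p \<le> real (l - 2)" "0 < K1" "0 < K2"
    and nonneg: "\<forall>z t. t > 0 \<longrightarrow> 0 \<le> u z t"
    and sol: "global_weak_solution \<gamma> p u0 u"
  defines "C \<equiv> grushin_const TYPE('n) TYPE('k) l"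
    and "V \<equiv> unit_ball_vol CARD('n) * unit_ball_vol CARD('k)"
    and "W \<equiv> \<lambda>w. power_density p u w * weight l S T w"
  shows "T powr (1 - \<gamma>) / l * (LINT w|lborel. W w) + (LINT z|lborel. u0 z * cutoff S z ^ l) \<le>
     K1 * (LINT w|lborel. W w) + K2 * (LINT w|lborel. W w * degeneracy S w)
      + (K1 powr (- 1 / (p - 1)) * (l / T) powr (p / (p - 1)) + K2 powr (- 1 / (p - 1)) * (C / S) powr (p / (p - 1)))
        * (V * S powr (CARD('n) / 2 + CARD('k)) * T)"
proof -
  have wsol: "weak_solution \<gamma> p u0 T u" if "0 < T" for T
    using sol that by (auto simp: global_weak_solution_def)
  have [measurable]: "power_density p u \<in> borel_measurable borel"
    by (rule measurable_power_density) (use wsol in \<open>auto simp: weak_solution_def\<close>)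
  note ineq = test_bump_inequality[OF par(1-5) nonneg wsol[OF par(3)]]
  have iW: "integrable lborel W" using ineq(1) unfolding W_def .
  have iWd: "integrable lborel (\<lambda>w. W w * degeneracy S w)"
  proof (rule Bochner_Integration.integrable_bound[OF iW])
    have "norm (W w * degeneracy S w) \<le> norm (W w)" for w
    proof -
      have "power_density p u w * (weight l S T w * degeneracy S w) \<le> power_density p u w * weight l S T w"
        using weight_degeneracy_le[OF par(4), of l T w] par by (intro mult_left_mono) auto
      then show ?thesis
        using degeneracy_nonneg[OF par(4), of w] by (simp add: W_def mult.assoc)
    qed
    then show "AE w in lborel. norm (W w * degeneracy S w) \<le> norm (W w)"
      by simp
  qed (simp add: W_def)
  let ?E = "K1 powr (- 1 / (p - 1)) * (l / T) powr (p / (p - 1)) + K2 powr (- 1 / (p - 1)) * (C / S) powr (p / (p - 1))"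
  let ?B = "indicator (support_box S T) :: ((real^'n) \<times> (real^'k)) \<times> real \<Rightarrow> real"
  let ?RHS = "\<lambda>w. K1 * W w + K2 * (W w * degeneracy S w) + ?E * ?B w"
  have iB: "integrable lborel ?B"
    by (rule integrable_indicator_support_box)
  have iR: "integrable lborel ?RHS"
    using iW iWd iB by (intro Bochner_Integration.integrable_add integrable_mult_right)
  have "T powr (1 - \<gamma>) / l * (LINT w|lborel. W w) + (LINT z|lborel. u0 z * cutoff S z ^ l) \<le> (LINT w|lborel. ?RHS w)"
    using ineq(3) unfolding W_def[symmetric]
  proof (rule order_trans, intro integral_mono ineq(2) iR)
    show "indicator (UNIV \<times> {0<..<T}) w * (- (u (fst w) (snd w) * grushin (test_bump l S T) (fst w) (snd w))
      - u (fst w) (snd w) * dtime (test_bump l S T) (fst w) (snd w)) \<le> ?RHS w" for w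
      unfolding W_def C_def by (rule test_bump_pointwise_bound[OF par(2-8) nonneg])
  qed
  also have "(LINT w|lborel. ?RHS w) = (LINT w|lborel. K1 * W w) + (LINT w|lborel. K2 * (W w * degeneracy S w)) + (LINT w|lborel. ?E * ?B w)"
    using iW iWd iB by (simp only: Bochner_Integration.integral_add Bochner_Integration.integrable_add integrable_mult_right)
  also have "\<dots> = K1 * (LINT w|lborel. W w) + K2 * (LINT w|lborel. W w * degeneracy S w) + ?E * (LINT w|lborel. ?B w)"
    by (simp only: integral_mult_right_zero)
  also have "(LINT w|lborel. ?B w) = V * S powr (CARD('n) / 2 + CARD('k)) * T"
    using measure_support_box[OF par(4,3), where 'a="real^'n" and 'b="real^'k"] by (simp add: V_def)
  finally show ?thesis .
qed

text \<open>If the weighted integral of u^p is zero, u vanishes almost everywhere on the part of the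
  strip where the cutoff is positive. Elsewhere the derivatives of the test function vanish, so the
  whole right side of the weak inequality is zero.\<close>

lemma vanishing_power_density_imp_initial_nonpos:
  fixes u :: "(real^'n) \<times> (real^'k) \<Rightarrow> real \<Rightarrow> real"
  assumes par: "0 < \<gamma>" "1 < p" "0 < T" "0 < S" "3 \<le> l"
    and nonneg: "\<forall>z t. t > 0 \<longrightarrow> 0 \<le> u z t"
    and sol: "weak_solution \<gamma> p u0 T u"
    and zero: "(LINT w|lborel. power_density p u w * weight l S T w) = 0"
  shows "(LINT z|lborel. u0 z * cutoff S z ^ l) \<le> 0"
proof -
  let ?R = "\<lambda>w. indicator (UNIV \<times> {0<..<T}) w * (- (u (fst w) (snd w) * grushin (test_bump l S T) (fst w) (snd w))
      - u (fst w) (snd w) * dtime (test_bump l S T) (fst w) (snd w))"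
  note ineq = test_bump_inequality[OF par nonneg sol]
  have "AE w in lborel. power_density p u w * weight l S T w = 0"
    using integral_nonneg_eq_0_iff_AE[OF ineq(1)] zero by simp
  then have "AE w in lborel. ?R w = 0"
  proof eventually_elim
    case (elim w)
    obtain z t where w: "w = (z, t)" by (cases w)
    show ?case
    proof (cases "0 < t \<and> t < T \<and> u z t \<noteq> 0")
      case True
      \<comment> \<open>For 0 < t < T the time factor is positive and u^p is nonzero, so the
        vanishing product leaves only the cutoff.\<close>
      then have "cutoff S z = 0"
        using elim par by (auto simp: w power_density_def weight_def)
      then have "grushin (test_bump l S T) z t = 0" "dtime (test_bump l S T) z t = 0"
        using par by (auto simp: grushin_test_bump dtime_test_bump power_0_left)
      then show ?thesis by (simp add: w)
    qed (auto simp: w indicator_def)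
  qed
  then have "(LINT w|lborel. ?R w) = 0"
    by (rule integral_eq_zero_AE)
  then show ?thesis
    using ineq(3) zero by simp
qed

section \<open>Limits in the parameters and of the weights\<close>

lemma nonpos_if_le_decaying:
  fixes x :: real
  assumes "a < 0" "b < 0" and "\<forall>\<^sub>F T in at_top. x \<le> A * T powr a + B * T powr b"
  shows "x \<le> 0"
proof -
  have "((\<lambda>T. A * T powr a + B * T powr b) \<longlongrightarrow> A * 0 + B * 0) at_top"
    using assms by (intro tendsto_intros tendsto_neg_powr filterlim_ident)
  then show ?thesis
    using tendsto_lowerbound[OF _ assms(3)] by simp
qed

text \<open>Limits in the order n, K, b. The exponent r has no prescribed sign, so the last summand
  must be removed by K for fixed b before b is sent to 0.\<close>

lemma nonpos_if_le_three_scales: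
  fixes x :: real
  assumes "0 < h" "0 < e"
    and D: "\<And>b. 0 < b \<Longrightarrow> D b \<longlonglongrightarrow> 0"
    and le: "\<And>b K. 0 < b \<Longrightarrow> 0 < K \<Longrightarrow>
      \<forall>\<^sub>F n in sequentially. x \<le> K * D b n + A * b powr h + K powr (- e) * (B * b powr r)"
  shows "x \<le> 0"
proof -
  have 1: "x \<le> A * b powr h + K powr (- e) * (B * b powr r)" if "0 < b" "0 < K" for b K
  proof -
    have "(\<lambda>n. K * D b n + A * b powr h + K powr (- e) * (B * b powr r)) \<longlonglongrightarrow>
        K * 0 + A * b powr h + K powr (- e) * (B * b powr r)"
      using D[OF that(1)] by (intro tendsto_intros)
    then show ?thesis
      using tendsto_lowerbound[OF _ le[OF that]] by simp
  qed
  have 2: "x \<le> A * b powr h" if b: "0 < b" for b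
  proof -
    have "((\<lambda>K. A * b powr h + K powr (- e) * (B * b powr r)) \<longlongrightarrow> A * b powr h + 0 * (B * b powr r)) at_top"
      using assms by (intro tendsto_intros tendsto_neg_powr filterlim_ident) auto
    moreover have "\<forall>\<^sub>F K in at_top. x \<le> A * b powr h + K powr (- e) * (B * b powr r)"
      using eventually_gt_at_top[of 0] by eventually_elim (rule 1[OF b])
    ultimately show ?thesis
      using tendsto_lowerbound by fastforce
  qed
  \<comment> \<open>Substituting b = 1/s turns b to 0 into a limit at infinity.\<close>
  have "\<forall>\<^sub>F s in at_top. x \<le> A * s powr (- h) + 0 * s powr (- h)"
    using eventually_gt_at_top[of 0]
  proof eventually_elim
    case (elim s)
    then show ?case
      using 2[of "s powr (- 1)"] unfolding powr_powr by simp
  qed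
  then show ?thesis
    by (rule nonpos_if_le_decaying[rotated 2]) (use assms(1) in auto)
qed

lemma cutoff_mono:
  assumes "0 < S" "S \<le> S'"
  shows "cutoff S z \<le> cutoff S' z"
  using assms unfolding cutoff_def
  by (intro max.mono order_refl diff_left_mono divide_left_mono power_mono mult_pos_pos) auto

lemma weight_mono:
  assumes "0 < S" "S \<le> S'" "0 < T" "T \<le> T'" "0 \<le> snd w"
  shows "weight l S T w \<le> weight l S' T' w"
  using assms unfolding weight_def
  by (intro power_mono mult_mono cutoff_mono max.mono order_refl diff_left_mono divide_left_mono) auto

lemma weight_le_1:
  assumes "0 < T" "0 \<le> snd w"
  shows "weight l S T w \<le> 1"
  using assms unfolding weight_def by (intro power_le_one mult_le_one) auto

lemma tendsto_cutoff_at_top: "((\<lambda>S. cutoff S z) \<longlongrightarrow> 1) at_top"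
proof -
  have "((\<lambda>S. max 0 (1 - grushin_gauge z / S\<^sup>2)) \<longlongrightarrow> max 0 (1 - 0)) at_top"
    by (intro tendsto_intros tendsto_divide_0[OF tendsto_const] filterlim_at_top_imp_at_infinity
        filterlim_pow_at_top filterlim_ident) auto
  then show ?thesis
    by (simp add: cutoff_def)
qed

lemma tendsto_weight:
  "(\<lambda>n. weight l (real (Suc n)) (real (Suc n)) w) \<longlonglongrightarrow> 1"
proof -
  have n: "filterlim (\<lambda>n. real (Suc n)) at_top sequentially"
    using filterlim_compose[OF filterlim_real_sequentially filterlim_Suc] .
  have "(\<lambda>n. (cutoff (real (Suc n)) (fst w) * max 0 (1 - snd w / real (Suc n))) ^ l) \<longlonglongrightarrow> (1 * max 0 (1 - 0)) ^ l"
    by (intro tendsto_intros filterlim_compose[OF tendsto_cutoff_at_top n] tendsto_divide_0[OF tendsto_const]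
        filterlim_at_top_imp_at_infinity n)
  then show ?thesis
    by (simp add: weight_def)
qed

text \<open>Dominated convergence with majorant |u0|: the cutoffs tend pointwise to 1, so the
  positive mass of \<open>u0\<close> survives for all large S.\<close>

lemma integral_cutoff_eventually_pos:
  fixes u0 :: "('a::euclidean_space \<times> 'b::euclidean_space) \<Rightarrow> real"
  assumes "integrable lborel u0" "0 < (LINT z|lborel. u0 z)"
  shows "\<forall>\<^sub>F S in at_top. 0 < (LINT z|lborel. u0 z * cutoff S z ^ l)"
proof -
  have [measurable]: "u0 \<in> borel_measurable borel"
    using borel_measurable_integrable[OF assms(1)] by simp
  have "((\<lambda>S. LINT z|lborel. u0 z * cutoff S z ^ l) \<longlongrightarrow> (LINT z|lborel. u0 z)) at_top"
  proof (rule integral_dominated_convergence_at_top[where w="\<lambda>z. norm (u0 z)"])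
    show "AE z in lborel. ((\<lambda>S. u0 z * cutoff S z ^ l) \<longlongrightarrow> u0 z) at_top"
    proof (rule AE_I2)
      show "((\<lambda>S. u0 z * cutoff S z ^ l) \<longlongrightarrow> u0 z) at_top" for z
        using tendsto_mult[OF tendsto_const[of "u0 z"] tendsto_power[OF tendsto_cutoff_at_top[of z], of l]] by simp
    qed
    have "norm (u0 z * cutoff S z ^ l) \<le> norm (u0 z)" for z S
      by (simp add: abs_mult mult_left_le power_le_one)
    then show "\<forall>\<^sub>F S in at_top. AE z in lborel. norm (u0 z * cutoff S z ^ l) \<le> norm (u0 z)"
      by simp
  qed (use assms in auto)
  then show ?thesis
    using assms(2) by (rule order_tendstoD(1))
qed

section \<open>Choice of the Young weights\<close>

text \<open>Both Young weights are taken proportional to T^(1-\<gamma>), the size of the memory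
  coefficient, which is then divided out. The time weight costs a quarter of the coefficient 1/l on
  the left, hence the 3/4; the space weight K stays free.\<close>

lemma scaled_energy_inequality:
  fixes u :: "(real^'n) \<times> (real^'k) \<Rightarrow> real \<Rightarrow> real"
  assumes par: "0 < \<gamma>" "1 < p" "0 < T" "0 < S" "3 \<le> l" "real l / p \<le> real (l - 2)" "0 < K"
    and nonneg: "\<forall>z t. t > 0 \<longrightarrow> 0 \<le> u z t"
    and sol: "global_weak_solution \<gamma> p u0 u"
    and init: "0 \<le> (LINT z|lborel. u0 z * cutoff S z ^ l)"
  defines "C \<equiv> grushin_const TYPE('n) TYPE('k) l"
    and "V \<equiv> unit_ball_vol CARD('n) * unit_ball_vol CARD('k)"
    and "W \<equiv> \<lambda>w. power_density p u w * weight l S T w"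
    and "h \<equiv> CARD('n) / 2 + CARD('k)"
    and "q \<equiv> p / (p - 1)"
    and "e \<equiv> 1 / (p - 1)"
  shows "3 / (4 * real l) * (LINT w|lborel. W w) \<le> K * (LINT w|lborel. W w * degeneracy S w)
      + ((1 / (4 * real l)) powr (- e) * l powr q * V) * (T powr (1 - (2 - \<gamma>) * q) * S powr h)
      + K powr (- e) * (C powr q * V * (T powr (1 - (1 - \<gamma>) * q) * S powr (h - q)))"
proof -
  define \<alpha> where "\<alpha> = 1 - \<gamma>"
  define L where "L = 1 / (4 * real l)"
  have pos: "0 < T powr \<alpha>" "0 < L" using par by (auto simp: L_def)
  have cancel: "inverse (T powr \<alpha>) * (T powr \<alpha> / l * x) = 1 / l * x"
    "inverse (T powr \<alpha>) * (y * T powr \<alpha> * x) = y * x" for x y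
    using par by simp_all
  have qe: "q = 1 + e" using par by (simp add: q_def e_def field_simps)
  have C: "0 \<le> C" unfolding C_def grushin_const_def by auto
  have "T powr (1 - \<gamma>) / l * (LINT w|lborel. W w) + (LINT z|lborel. u0 z * cutoff S z ^ l) \<le>
     (L * T powr \<alpha>) * (LINT w|lborel. W w) + (K * T powr \<alpha>) * (LINT w|lborel. W w * degeneracy S w)
      + ((L * T powr \<alpha>) powr (- 1 / (p - 1)) * (l / T) powr (p / (p - 1))
        + (K * T powr \<alpha>) powr (- 1 / (p - 1)) * (C / S) powr (p / (p - 1))) * (V * S powr (CARD('n) / 2 + CARD('k)) * T)"
    unfolding W_def C_def V_def by (rule energy_inequality) (use assms pos in auto)
  then have "T powr \<alpha> / l * (LINT w|lborel. W w) \<le>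
     (L * T powr \<alpha>) * (LINT w|lborel. W w) + (K * T powr \<alpha>) * (LINT w|lborel. W w * degeneracy S w)
      + ((L * T powr \<alpha>) powr (- e) * (l / T) powr q
        + (K * T powr \<alpha>) powr (- e) * (C / S) powr q) * (V * S powr h * T)"
    using init by (simp add: \<alpha>_def q_def e_def h_def)
  then have "inverse (T powr \<alpha>) * (T powr \<alpha> / l * (LINT w|lborel. W w)) \<le> inverse (T powr \<alpha>) * (
     (L * T powr \<alpha>) * (LINT w|lborel. W w) + (K * T powr \<alpha>) * (LINT w|lborel. W w * degeneracy S w)
      + ((L * T powr \<alpha>) powr (- e) * (l / T) powr q
        + (K * T powr \<alpha>) powr (- e) * (C / S) powr q) * (V * S powr h * T))"
    using pos by (intro mult_left_mono) auto
  then have main: "1 / l * (LINT w|lborel. W w) \<le> L * (LINT w|lborel. W w) + K * (LINT w|lborel. W w * degeneracy S w)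
      + inverse (T powr \<alpha>) * ((L * T powr \<alpha>) powr (- e) * (l / T) powr q * (V * S powr h * T))
        + inverse (T powr \<alpha>) * ((K * T powr \<alpha>) powr (- e) * (C / S) powr q * (V * S powr h * T))"
    by (simp only: ring_distribs cancel)
  have time_term: "inverse (T powr \<alpha>) * ((X * T powr \<alpha>) powr (- e) * (l / T) powr q * (V * S powr h * T))
    = (X powr (- e) * l powr q * V) * (T powr (1 - (2 - \<gamma>) * q) * S powr h)" if "0 < X" for X
  proof -
    \<comment> \<open>The four powers of T come from the division by \<open>T powr \<alpha>\<close>,
      the Young weight, the time derivative and the length of the time interval; they combine
      through \<open>q = 1 + e\<close>.\<close>
    have "1 - (2 - \<gamma>) * q = - \<alpha> + - (\<alpha> * e) + - q + 1"
      by (simp add: \<alpha>_def qe algebra_simps)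
    then have "T powr (1 - (2 - \<gamma>) * q) = T powr (- \<alpha>) * T powr (- (\<alpha> * e)) * T powr (- q) * T powr 1"
      by (simp only: powr_add)
    moreover have "(l / T) powr q = l powr q * T powr (- q)"
      using par by (simp add: powr_divide powr_minus_divide)
    moreover have "(X * T powr \<alpha>) powr (- e) = X powr (- e) * T powr (- (\<alpha> * e))"
      using that by (simp add: powr_mult powr_powr)
    ultimately show ?thesis
      using par by (simp add: powr_minus)
  qed
  have space_term: "inverse (T powr \<alpha>) * ((X * T powr \<alpha>) powr (- e) * (C / S) powr q * (V * S powr h * T))
    = X powr (- e) * (C powr q * V * (T powr (1 - (1 - \<gamma>) * q) * S powr (h - q)))" if "0 < X" for X
  proof -
    have "1 - (1 - \<gamma>) * q = - \<alpha> + - (\<alpha> * e) + 1"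
      by (simp add: \<alpha>_def qe algebra_simps)
    then have "T powr (1 - (1 - \<gamma>) * q) = T powr (- \<alpha>) * T powr (- (\<alpha> * e)) * T powr 1"
      by (simp only: powr_add)
    moreover have "(C / S) powr q * S powr h = C powr q * S powr (h - q)"
      using par C by (simp add: powr_divide powr_diff)
    moreover have "(X * T powr \<alpha>) powr (- e) = X powr (- e) * T powr (- (\<alpha> * e))"
      using that by (simp add: powr_mult powr_powr)
    ultimately show ?thesis
      using par by (simp add: powr_minus mult_ac)
  qed
  have "1 / real l * x = L * x + 3 / (4 * real l) * x" for x
    using par by (simp add: L_def field_simps)
  from main[unfolded time_term[OF pos(2)] space_term[OF par(7)] this] show ?thesis
    unfolding L_def[symmetric] by linarith
qed

section \<open>Nonexistence in the two ranges of p\<close>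

theorem theorem2:
  fixes u0 :: "(real^'n) \<times> (real^'k) \<Rightarrow> real" and \<gamma> p :: real
  assumes "0 < \<gamma>" and "\<gamma> < 1" and "p > 1"
    and "integrable lborel u0" and "(LINT z|lborel. u0 z) > 0"
    and "p \<le> 1 + 2 * (2 - \<gamma>) / (real CARD('n) + 2 * real CARD('k) - 2 + 2 * \<gamma>)
         \<or> p < 1 / \<gamma>"
  shows "\<not> (\<exists>u :: (real^'n) \<times> (real^'k) \<Rightarrow> real \<Rightarrow> real.
             (\<forall>z t. t > 0 \<longrightarrow> 0 \<le> u z t) \<and> global_weak_solution \<gamma> p u0 u)"
proof
  assume "\<exists>u :: (real^'n) \<times> (real^'k) \<Rightarrow> real \<Rightarrow> real.
             (\<forall>z t. t > 0 \<longrightarrow> 0 \<le> u z t) \<and> global_weak_solution \<gamma> p u0 u"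
  then obtain u :: "(real^'n) \<times> (real^'k) \<Rightarrow> real \<Rightarrow> real" where
    nonneg: "\<forall>z t. t > 0 \<longrightarrow> 0 \<le> u z t" and sol: "global_weak_solution \<gamma> p u0 u"
    by blast
  define q e h where "q = p / (p - 1)" and "e = 1 / (p - 1)" and "h = CARD('n) / 2 + CARD('k)"
  \<comment> \<open>The condition l/p <= l-2 is equivalent to l >= 2q; the summand 3 secures two
    continuous space derivatives of the cutoff power.\<close>
  define l where "l = nat \<lceil>2 * q\<rceil> + 3"
  have q: "1 < q" and e: "0 < e"
    using assms by (auto simp: q_def e_def)
  have h: "0 < h"
    unfolding h_def by (intro add_pos_pos divide_pos_pos) auto
  have l3: "3 \<le> l" by (simp add: l_def)
  have l2: "real l / p \<le> real (l - 2)"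
  proof -
    have "2 * q \<le> real l" by (simp add: l_def) linarith
    then have "2 * p \<le> real l * (p - 1)"
      using assms by (simp add: q_def field_simps)
    then have "real l / p \<le> real l - 2"
      using assms by (simp add: field_simps)
    then show ?thesis
      using l3 by simp
  qed
  define g where "g = power_density p u"
  define W where "W S T = (LINT w|lborel. g w * weight l S T w)" for S T
  define D where "D S T = (LINT w|lborel. g w * weight l S T w * degeneracy S w)" for S T
  define A where "A = (1 / (4 * real l)) powr (- e) * l powr q * (unit_ball_vol CARD('n) * unit_ball_vol CARD('k))"
  define B where "B = grushin_const TYPE('n) TYPE('k) l powr q * (unit_ball_vol CARD('n) * unit_ball_vol CARD('k))"
  have AB: "0 \<le> A" "0 \<le> B"
    by (auto simp: A_def B_def)
  have wsol: "weak_solution \<gamma> p u0 T u" if "0 < T" for T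
    using sol that by (auto simp: global_weak_solution_def)
  have [measurable]: "g \<in> borel_measurable borel"
    unfolding g_def by (rule measurable_power_density) (use wsol in \<open>auto simp: weak_solution_def\<close>)
  have g0: "0 \<le> g w" for w by (simp add: g_def)
  have g_t: "g w = 0" if "\<not> 0 < snd w" for w
    using that by (cases w) (simp add: g_def power_density_def)
  have int: "integrable lborel (\<lambda>w. g w * weight l S T w)" if "0 < S" "0 < T" for S T
    unfolding g_def by (rule test_bump_inequality(1)[OF assms(1,3) that(2,1) l3 nonneg wsol[OF that(2)]])
  have W0: "0 \<le> W S T" for S T
    unfolding W_def using g0 by (intro integral_nonneg_AE) auto
  have gw_mono: "g w * weight l S T w \<le> g w * weight l S' T' w" if "0 < S" "S \<le> S'" "0 < T" "T \<le> T'" for S S' T T' w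
    using g0[of w] g_t[of w] weight_mono[OF that, of w l] by (cases "0 < snd w") (auto intro: mult_left_mono)
  have W_mono: "W S T \<le> W S' T'" if "0 < S" "S \<le> S'" "0 < T" "T \<le> T'" for S S' T T'
    unfolding W_def using that by (intro integral_mono int gw_mono) auto
  have D_le: "D S T \<le> W S T" if "0 < S" "0 < T" for S T
  proof (cases "integrable lborel (\<lambda>w. g w * weight l S T w * degeneracy S w)")
    case True
    have "g w * weight l S T w * degeneracy S w \<le> g w * weight l S T w" for w
      unfolding mult.assoc using g0 l3 that by (intro mult_left_mono weight_degeneracy_le) auto
    then show ?thesis
      unfolding D_def W_def using int[OF that] True by (intro integral_mono)
  next
    \<comment> \<open>A non-integrable function has integral 0 by default, so the bound reduces to W
      being nonnegative.\<close>
    case False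
    then show ?thesis
      using W0 by (simp add: D_def not_integrable_integral_eq)
  qed
  obtain S0 where S0: "0 < S0" "\<And>S. S0 \<le> S \<Longrightarrow> 0 < (LINT z|lborel. u0 z * cutoff S z ^ l)"
  proof -
    have "\<forall>\<^sub>F S in at_top. 0 < S \<and> 0 < (LINT z|lborel. u0 z * cutoff S z ^ l)"
      using integral_cutoff_eventually_pos[OF assms(4,5), of l] eventually_gt_at_top[of 0]
      by eventually_elim auto
    then show ?thesis
      using that unfolding eventually_at_top_linorder by blast
  qed
  have energy: "3 / (4 * real l) * W S T \<le> K * D S T + A * (T powr (1 - (2 - \<gamma>) * q) * S powr h)
      + K powr (- e) * (B * (T powr (1 - (1 - \<gamma>) * q) * S powr (h - q)))"
    if "S0 \<le> S" "0 < T" "0 < K" for S T K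
    unfolding W_def D_def A_def B_def g_def q_def e_def h_def
    by (rule scaled_energy_inequality) (use assms l3 l2 nonneg sol that S0 in \<open>auto intro: less_imp_le\<close>)
  \<comment> \<open>With K = 1/(4l) and D <= W a second quarter of 1/l is absorbed, leaving one
    half.\<close>
  have energy': "1 / (2 * real l) * W S T \<le> A * (T powr (1 - (2 - \<gamma>) * q) * S powr h)
      + (1 / (4 * real l)) powr (- e) * (B * (T powr (1 - (1 - \<gamma>) * q) * S powr (h - q)))"
    if "S0 \<le> S" "0 < T" for S T
  proof -
    have "1 / (4 * real l) * D S T \<le> 1 / (4 * real l) * W S T"
      using D_le[of S T] that S0 by (intro mult_left_mono) auto
    moreover have "3 / (4 * real l) * x = 1 / (4 * real l) * x + 1 / (2 * real l) * x" for x
      by (simp add: field_simps)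
    ultimately show ?thesis
      using energy[OF that, of "1 / (4 * real l)"] l3 by simp
  qed
  \<comment> \<open>One fixed pair of scales suffices for the contradiction: W increases in both
    arguments, so bounds at larger scales pass down to it.\<close>
  have "W S0 1 \<le> 0"
  proof (cases "p < 1 / \<gamma>")
    case True
    \<comment> \<open>Division by p - 1 gives (1-\<gamma>) q > 1, so with S fixed the powers of T in
      both Young terms decay, whatever the dimensions.\<close>
    then have "p - 1 < (1 - \<gamma>) * p"
      using assms by (simp add: field_simps)
    then have b: "1 - (1 - \<gamma>) * q < 0"
      using assms by (simp add: q_def field_simps)
    then have a: "1 - (2 - \<gamma>) * q < 0"
      using q by (simp add: algebra_simps)
    have "\<forall>\<^sub>F T in at_top. 1 / (2 * real l) * W S0 1 \<le> (A * S0 powr h) * T powr (1 - (2 - \<gamma>) * q)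
      + ((1 / (4 * real l)) powr (- e) * B * S0 powr (h - q)) * T powr (1 - (1 - \<gamma>) * q)"
      using eventually_ge_at_top[of 1]
    proof eventually_elim
      case (elim T)
      have "1 / (2 * real l) * W S0 1 \<le> 1 / (2 * real l) * W S0 T"
        using W_mono[of S0 S0 1 T] S0 elim by (intro mult_left_mono) auto
      also have "\<dots> \<le> A * (T powr (1 - (2 - \<gamma>) * q) * S0 powr h)
        + (1 / (4 * real l)) powr (- e) * (B * (T powr (1 - (1 - \<gamma>) * q) * S0 powr (h - q)))"
        using elim by (intro energy') auto
      finally show ?case by (simp only: mult_ac)
    qed
    then have "1 / (2 * real l) * W S0 1 \<le> 0"
      by (rule nonpos_if_le_decaying[OF a b])
    then show ?thesis
      using l3 by (simp add: divide_le_0_iff)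
  next
    case False
    \<comment> \<open>The common power of T in both Young terms when S = bT. Since 2(h - 1 +
      \<gamma>) is the denominator in the hypothesis, the first alternative says exactly that \<xi>
      is nonpositive.\<close>
    define \<xi> where "\<xi> = 1 + h - (2 - \<gamma>) * q"
    have \<xi>: "\<xi> \<le> 0"
    proof -
      have d: "0 < h - 1 + \<gamma>"
      proof -
        have "1 \<le> real CARD('k)" "0 < real CARD('n)" by (auto simp: Suc_le_eq)
        then show ?thesis
          using assms(1) unfolding h_def by linarith
      qed
      have "p \<le> 1 + 2 * (2 - \<gamma>) / (2 * (h - 1 + \<gamma>))"
        using False assms(6) by (simp add: h_def algebra_simps)
      then have "(p - 1) * (h - 1 + \<gamma>) \<le> 2 - \<gamma>"
        using d by (simp add: field_simps)
      then have "(1 + h) * (p - 1) \<le> (2 - \<gamma>) * p"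
        by (simp add: algebra_simps)
      then have "1 + h \<le> (2 - \<gamma>) * q"
        using assms(3) by (simp add: q_def field_simps)
      then show ?thesis by (simp add: \<xi>_def)
    qed
    have scale: "T powr (1 - (2 - \<gamma>) * q) * (b * T) powr h \<le> b powr h"
      "T powr (1 - (1 - \<gamma>) * q) * (b * T) powr (h - q) \<le> b powr (h - q)" if "1 \<le> T" "0 < b" for b T
    proof -
      have "T powr \<xi> \<le> 1"
        using powr_mono[OF \<xi> that(1)] that by simp
      moreover have "T powr (1 - (2 - \<gamma>) * q) * (b * T) powr h = T powr \<xi> * b powr h"
        using that by (simp add: powr_mult powr_add[symmetric] \<xi>_def algebra_simps)
      moreover have "T powr (1 - (1 - \<gamma>) * q) * (b * T) powr (h - q) = T powr \<xi> * b powr (h - q)"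
        using that by (simp add: powr_mult powr_add[symmetric] \<xi>_def algebra_simps)
      ultimately show "T powr (1 - (2 - \<gamma>) * q) * (b * T) powr h \<le> b powr h"
        "T powr (1 - (1 - \<gamma>) * q) * (b * T) powr (h - q) \<le> b powr (h - q)"
        by (simp_all add: mult_left_le_one_le)
    qed
    define M where "M = A + (1 / (4 * real l)) powr (- e) * B"
    have bound: "W T T \<le> 2 * real l * M" if T: "1 \<le> T" "S0 \<le> T" for T
    proof -
      have "1 / (2 * real l) * W T T \<le> A * (T powr (1 - (2 - \<gamma>) * q) * T powr h)
        + (1 / (4 * real l)) powr (- e) * (B * (T powr (1 - (1 - \<gamma>) * q) * T powr (h - q)))"
        using T by (intro energy') auto
      also have "\<dots> \<le> A * 1 + (1 / (4 * real l)) powr (- e) * (B * 1)"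
        using scale[OF T(1), of 1] AB by (intro add_mono mult_left_mono) auto
      finally show ?thesis
        using l3 by (simp add: M_def field_simps)
    qed
    have int_g: "integrable lborel g"
    proof -
      let ?f = "\<lambda>n w. g w * weight l (real (Suc n)) (real (Suc n)) w"
      have mono: "W (real (Suc m)) (real (Suc m)) \<le> W (real (Suc n)) (real (Suc n))" if "m \<le> n" for m n
        using that by (intro W_mono) auto
      obtain x where x: "(\<lambda>n. W (real (Suc n)) (real (Suc n))) \<longlonglongrightarrow> x"
      proof (rule incseq_convergent[of "\<lambda>n. W (real (Suc n)) (real (Suc n))" "2 * real l * M"])
        show "incseq (\<lambda>n. W (real (Suc n)) (real (Suc n)))"
          using mono unfolding incseq_def by auto
        show "\<forall>n. W (real (Suc n)) (real (Suc n)) \<le> 2 * real l * M"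
        proof
          \<comment> \<open>The bound holds only from \<open>S0\<close> on; smaller indices are
            compared with a larger one by monotonicity.\<close>
          fix n
          let ?m = "max n (nat \<lceil>S0\<rceil>)"
          have "W (real (Suc n)) (real (Suc n)) \<le> W (real (Suc ?m)) (real (Suc ?m))"
            by (rule mono) simp
          also have "\<dots> \<le> 2 * real l * M"
            by (rule bound) (simp, linarith)
          finally show "W (real (Suc n)) (real (Suc n)) \<le> 2 * real l * M" .
        qed
      qed auto
      show ?thesis
      proof (rule integrable_monotone_convergence[where f = ?f])
        show "integrable lborel (?f n)" for n by (rule int) auto
        show "AE w in lborel. mono (\<lambda>n. ?f n w)"
          by (intro AE_I2 monoI gw_mono) auto
        show "AE w in lborel. (\<lambda>n. ?f n w) \<longlonglongrightarrow> g w"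
        proof (rule AE_I2)
          show "(\<lambda>n. ?f n w) \<longlonglongrightarrow> g w" for w
            using tendsto_mult[OF tendsto_const tendsto_weight[of l w], of "g w"] by simp
        qed
        show "(\<lambda>n. LINT w|lborel. ?f n w) \<longlonglongrightarrow> x"
          using x by (simp add: W_def)
      qed simp
    qed
    \<comment> \<open>Dominated convergence with majorant \<open>g\<close>, integrable by the
      previous step. The weight need not tend to 0: at each fixed point |x|^2/S does, while on the
      support it is at most 1.\<close>
    have D_lim: "(\<lambda>n. D (b * real (Suc n)) (real (Suc n))) \<longlonglongrightarrow> 0" if b: "0 < b" for b
    proof -
      let ?f = "\<lambda>n w. g w * weight l (b * real (Suc n)) (real (Suc n)) w * degeneracy (b * real (Suc n)) w"
      have bn: "0 < b * real (Suc n)" for n using b by simp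
      have f0: "0 \<le> ?f n w" for n w
        by (intro mult_nonneg_nonneg g0 weight_nonneg degeneracy_nonneg bn)
      have gw: "g w * weight l (b * real (Suc n)) (real (Suc n)) w \<le> g w" for n w
        using g0[of w] g_t[of w] weight_le_1[of "real (Suc n)" w l "b * real (Suc n)"]
        by (cases "0 < snd w") (auto intro: mult_left_le)
      have "(\<lambda>n. LINT w|lborel. ?f n w) \<longlonglongrightarrow> (LINT w|(lborel :: (((real^'n) \<times> (real^'k)) \<times> real) measure). 0)"
      proof (rule integral_dominated_convergence[where w = g])
        show "AE w in lborel. (\<lambda>n. ?f n w) \<longlonglongrightarrow> 0"
        proof (rule AE_I2)
          fix w :: "((real^'n) \<times> (real^'k)) \<times> real"
          have "filterlim (\<lambda>n. b * real (Suc n)) at_top sequentially"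
            using filterlim_tendsto_pos_mult_at_top[OF tendsto_const b
              filterlim_compose[OF filterlim_real_sequentially filterlim_Suc]] .
          then have "(\<lambda>n. degeneracy (b * real (Suc n)) w) \<longlonglongrightarrow> 0"
            unfolding degeneracy_def
            by (intro tendsto_divide_0[OF tendsto_const] filterlim_at_top_imp_at_infinity)
          from tendsto_mult[OF tendsto_const this, of "g w"]
          have lim: "(\<lambda>n. g w * degeneracy (b * real (Suc n)) w) \<longlonglongrightarrow> 0"
            by simp
          show "(\<lambda>n. ?f n w) \<longlonglongrightarrow> 0"
          proof (rule tendsto_sandwich[OF _ _ tendsto_const lim])
            show "\<forall>\<^sub>F n in sequentially. 0 \<le> ?f n w"
              by (intro always_eventually allI f0)
            show "\<forall>\<^sub>F n in sequentially. ?f n w \<le> g w * degeneracy (b * real (Suc n)) w"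
              by (intro always_eventually allI mult_right_mono gw degeneracy_nonneg bn)
          qed
        qed
        show "AE w in lborel. norm (?f n w) \<le> g w" for n
        proof (rule AE_I2)
          fix w
          have "g w * (weight l (b * real (Suc n)) (real (Suc n)) w * degeneracy (b * real (Suc n)) w)
            \<le> g w * weight l (b * real (Suc n)) (real (Suc n)) w"
            using g0 l3 by (intro mult_left_mono weight_degeneracy_le bn) auto
          then show "norm (?f n w) \<le> g w"
            using f0[of w n] gw[of w n] by (simp add: mult.assoc)
        qed
      qed (use int_g in auto)
      then show ?thesis
        by (simp add: D_def)
    qed
    have "3 / (4 * real l) * W S0 1 \<le> 0"
    proof (rule nonpos_if_le_three_scales[OF h e D_lim, where A = A and B = B and r = "h - q"])
      fix b K :: real
      assume bK: "0 < b" "0 < K"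
      have "\<forall>\<^sub>F n in sequentially. S0 / b \<le> real (Suc n)"
        by (rule eventually_sequentiallyI[of "nat \<lceil>S0 / b\<rceil>"]) linarith
      then show "\<forall>\<^sub>F n in sequentially. 3 / (4 * real l) * W S0 1 \<le> K * D (b * real (Suc n)) (real (Suc n))
          + A * b powr h + K powr (- e) * (B * b powr (h - q))"
      proof eventually_elim
        case (elim n)
        let ?T = "real (Suc n)"
        have S: "S0 \<le> b * ?T"
          using elim bK by (simp add: field_simps)
        have "3 / (4 * real l) * W S0 1 \<le> 3 / (4 * real l) * W (b * ?T) ?T"
          using S S0 by (intro mult_left_mono W_mono) auto
        also have "\<dots> \<le> K * D (b * ?T) ?T + A * (?T powr (1 - (2 - \<gamma>) * q) * (b * ?T) powr h)
            + K powr (- e) * (B * (?T powr (1 - (1 - \<gamma>) * q) * (b * ?T) powr (h - q)))"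
          using S bK by (intro energy) auto
        also have "\<dots> \<le> K * D (b * ?T) ?T + A * b powr h + K powr (- e) * (B * b powr (h - q))"
          using scale[of ?T b] bK AB by (intro add_mono mult_left_mono order_refl) auto
        finally show ?case .
      qed
    qed auto
    then show ?thesis
      using l3 by (simp add: divide_le_0_iff)
  qed
  then have "W S0 1 = 0"
    using W0[of S0 1] by simp
  then have "(LINT z|lborel. u0 z * cutoff S0 z ^ l) \<le> 0"
    using vanishing_power_density_imp_initial_nonpos[OF assms(1,3) _ S0(1) l3 nonneg wsol, of 1]
    by (simp add: W_def g_def)
  then show False
    using S0(2)[of S0] by simp
qed

end
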